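(* Let $K$, $M$, $X$, $\Lambda$, $\Lambda_Y$, $\Lambda_Z$, $\Gamma$, $G$, $H$, $\widehat D$, $G_W$, $H_W$, $F_W$ be as defined in the context, where $M_A$, $\widehat S$, $\widehat M_S$ are symmetric positive definite. Then the following statements are true. (i) The matrices $\Lambda_Y$, $\Lambda_Z$ and $\Gamma$ are all diagonal matrices and satisfy $$\Gamma=\begin{cases}0,&\text{if } Y_A+Z_A=0,\\ \Lambda,&\text{if } Y_A+Z_A=M_A^{-1},\\ 2\Lambda-\Lambda^2,&\text{if } Y_A+Z_A=2M_A^{-1},\end{cases}$$ and $$I-\Gamma=(I-\Lambda_Y)(I-\Lambda_Z)=\Delta_+^2-\Delta_-^2,$$ where $\Delta_+$, $\Delta_-$ are the non-negative diagonal matrices with $$(\Delta_+)_{ii}=\sqrt{\max\{(I-\Gamma)_{ii},0\}},\qquad (\Delta_-)_{ii}=\sqrt{\max\{(\Gamma-I)_{ii},0\}},\qquad i=1,\dots,n.$$ (ii) The matrix $M^{-1}K$ is equivalent in eigenvalues to (i.e. has the same eigenvalues as) $$K_P=\begin{pmatrix} \Lambda & (\Delta_++\Delta_-)\Lambda^{1/2}G^T & (\Delta_++\Delta_-)\Lambda^{1/2}G_W^TH_W^T\\ -G\Lambda^{1/2}(\Delta_+-\Delta_-) & G\Gamma G^T & G\Gamma G_W^TH_W^T-H^T\\ H_WG_W\Lambda^{1/2}(\Delta_+-\Delta_-) & H-H_WG_W\Gamma G^T & \widehat D+H_WF_WH_W^T \end{pmatrix}.$$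
   Context: Let $A\in\mathbb R^{n\times n}$ be symmetric positive definite (SPD), $B\in\mathbb R^{m\times n}$ have full row rank ($m\le n$), $D\in\mathbb R^{l\times l}$ be symmetric positive semi-definite, and $C\in\mathbb R^{l\times m}$, where $C$ has full row rank whenever $D$ is not SPD. Put $$K=\begin{pmatrix}A&B^T&0\\ B&0&C^T\\ 0&C&D\end{pmatrix}.$$ Let $M_A\in\mathbb R^{n\times n}$, $\widehat S\in\mathbb R^{m\times m}$, $\widehat M_S\in\mathbb R^{l\times l}$ be SPD matrices (thought of as approximations of $A$, $S=BA^{-1}B^T$ and $M_S=D+CS^{-1}C^T$, respectively). Let $W_S\in\{0,\widehat S^{-1}\}$ and $Y_A,Z_A\in\{0,M_A^{-1}\}$ (chosen independently), and $$M=\begin{pmatrix}I&0&0\\ BY_A&I&0\\ 0&-CW_S&I\end{pmatrix}\begin{pmatrix}M_A&0&0\\ 0&-\widehat S&0\\ 0&0&\widehat M_S\end{pmatrix}\begin{pmatrix}I&Z_AB^T&0\\ 0&I&-W_SC^T\\ 0&0&I\end{pmatrix}.$$ Since $A^{1/2}M_A^{-1}A^{1/2}$ is SPD, fix an orthogonal matrix $X$ such that $\Lambda=X^TA^{1/2}M_A^{-1}A^{1/2}X$ is diagonal. Define $$\Lambda_Y=X^TA^{1/2}Y_AA^{1/2}X,\quad \Lambda_Z=X^TA^{1/2}Z_AA^{1/2}X,\quad \Gamma=\Lambda_Y+\Lambda_Z-\Lambda_Y\Lambda_Z,$$ $$G=\widehat S^{-1/2}BA^{-1/2}X,\quad H=\widehat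 M_S^{-1/2}C\widehat S^{-1/2},\quad \widehat D=\widehat M_S^{-1/2}D\widehat M_S^{-1/2},$$ $$G_W=W_S^{1/2}BA^{-1/2}X,\quad H_W=\widehat M_S^{-1/2}CW_S^{1/2},\quad F_W=2I-G_W\Gamma G_W^T.$$ Square roots of symmetric positive semi-definite matrices are the symmetric positive semi-definite ones. *)

theory Defs
  imports
    Complex_Main
    "Jordan_Normal_Form.Matrix"
    "Jordan_Normal_Form.Char_Poly"
    "Jordan_Normal_Form.Gauss_Jordan_Elimination"
    "Jordan_Normal_Form.DL_Rank"
begin

definition sym_psd :: "nat \<Rightarrow> real mat \<Rightarrow> bool" where
  "sym_psd n A \<longleftrightarrow> A \<in> carrier_mat n n \<and> transpose_mat A = A \<and>
     (\<forall>v\<in>carrier_vec n. 0 \<le> v \<bullet> (A *\<^sub>v v))"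

definition spd :: "nat \<Rightarrow> real mat \<Rightarrow> bool" where
  "spd n A \<longleftrightarrow> A \<in> carrier_mat n n \<and> transpose_mat A = A \<and>
     (\<forall>v\<in>carrier_vec n. v \<noteq> 0\<^sub>v n \<longrightarrow> 0 < v \<bullet> (A *\<^sub>v v))"

text \<open>The constant \<open>vec_space.rank\<close> is the column rank of a matrix with \<open>r\<close> rows.\<close>

definition full_row_rank :: "real mat \<Rightarrow> bool" where
  "full_row_rank B \<longleftrightarrow> vec_space.rank (dim_row B) B = dim_row B"

text \<open>The library predicate \<open>orthogonal_mat\<close> only asks for pairwise orthogonal nonzero columns,
  so it does not express orthogonality in the sense of \<open>X\<^sup>T X = I\<close>.\<close>

definition orthogonal_matrix :: "nat \<Rightarrow> real mat \<Rightarrow> bool" where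
  "orthogonal_matrix n X \<longleftrightarrow> X \<in> carrier_mat n n \<and>
     transpose_mat X * X = 1\<^sub>m n \<and> X * transpose_mat X = 1\<^sub>m n"

text \<open>Unspecified for singular or non-square matrices.\<close>

definition mat_inv :: "real mat \<Rightarrow> real mat" where
  "mat_inv A = the (mat_inverse A)"

text \<open>The unique symmetric positive semi-definite square root; meaningful for symmetric
  positive semi-definite arguments.\<close>

definition mat_sqrt :: "real mat \<Rightarrow> real mat" where
  "mat_sqrt A = (THE R. sym_psd (dim_row A) R \<and> R * R = A)"

definition mat_inv_sqrt :: "real mat \<Rightarrow> real mat" where
  "mat_inv_sqrt A = mat_inv (mat_sqrt A)"

text \<open>The row of blocks \<open>(P Q)\<close>, obtained by stacking the transposed blocks.\<close>

definition beside :: "real mat \<Rightarrow> real mat \<Rightarrow> real mat" where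
  "beside P Q = transpose_mat (transpose_mat P @\<^sub>r transpose_mat Q)"

definition block3 ::
  "real mat \<Rightarrow> real mat \<Rightarrow> real mat \<Rightarrow>
   real mat \<Rightarrow> real mat \<Rightarrow> real mat \<Rightarrow>
   real mat \<Rightarrow> real mat \<Rightarrow> real mat \<Rightarrow> real mat" where
  "block3 P11 P12 P13
          P21 P22 P23
          P31 P32 P33 =
     four_block_mat (four_block_mat P11 P12 P21 P22) (P13 @\<^sub>r P23) (beside P31 P32) P33"

text \<open>Eigenvalues of real matrices are taken over the complex numbers and are compared
  together with their algebraic multiplicities.\<close>

definition same_eigenvalues :: "real mat \<Rightarrow> real mat \<Rightarrow> bool" where
  "same_eigenvalues P Q \<longleftrightarrow>
     (let Pc = map_mat complex_of_real P; Qc = map_mat complex_of_real Q in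
      \<forall>z. (eigenvalue Pc z \<longleftrightarrow> eigenvalue Qc z) \<and>
          Polynomial.order z (char_poly Pc) = Polynomial.order z (char_poly Qc))"

end

theory Submission
  imports Defs
begin

text \<open>The proof of the eigenvalue statement splits into a similarity and a rescaling.

Write $M = LEU$ for the three given factors.  Then $M^{-1}K = U^{-1}E^{-1}L^{-1}K$ is similar to
$E^{-1}L^{-1}KU^{-1}$, where all inverses are those of block triangular matrices and can be written out.
Changing the basis further by
$\mathrm{diag}(A^{-1/2}X, \widehat S^{-1/2}, \widehat M_S^{-1/2})$ turns it into a matrix $K_1$ that agrees
with $K_P$ except for the scaling of the first block row and column: $K_1$ has the factor
$\Lambda(I - \Lambda_Z)$ in the row and $I - \Lambda_Y$ in the column, where $K_P$ has
$(\Delta_+ + \Delta_-)\Lambda^{1/2}$ and $\Lambda^{1/2}(\Delta_+ - \Delta_-)$.  This is the lemma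
\<open>char_poly_preconditioned\<close>.

Both pairs of diagonal factors have the same product
$\Lambda(I - \Lambda_Y)(I - \Lambda_Z) = \Lambda(\Delta_+^2 - \Delta_-^2)$.  If $I - \Gamma$ is
invertible, a diagonal change of basis therefore carries $K_1$ to $K_P$.  If $\Lambda$ has
an eigenvalue $1$ and exactly one of $Y_A$, $Z_A$ vanishes, only one of the corresponding factors in
$K_1$ is zero, while both are zero in $K_P$, and the two matrices need not be similar.  They still have
the same characteristic polynomial: since the leading block $\Lambda$ is diagonal, the
Schur complement of $zI - \Lambda$ depends on the two factors only through their product.  This
holds for all but finitely many $z$, hence identically (\<open>char_poly_arrow_scaling\<close>).

The first statement is a computation with diagonal matrices, as $\Lambda_Y$ and $\Lambda_Z$ are $0$ or
$\Lambda$.  That all the square roots behave as expected rests on existence and uniqueness of the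
positive semi-definite square root, which follow from the real spectral theorem; the latter is proved by
deflation with Householder reflections.\<close>

section \<open>Matrix algebra as rewriting\<close>

text \<open>The ring laws below carry side conditions on dimensions instead of carrier sets.  Carrier premises
contain an inner dimension that does not occur in the conclusion, so the simplifier cannot use such
laws; the conditions stated here are decided by rewriting once the dimensions of the atoms are known.\<close>

lemma mult_assoc_dim: "dim_col A = dim_row B \<Longrightarrow> dim_col B = dim_row C \<Longrightarrow> A * B * C = A * (B * C)"
  for A B C :: "real mat"
  by (rule assoc_mult_mat) auto

lemma add_mult_dim: "dim_row A = dim_row B \<Longrightarrow> dim_col A = dim_col B \<Longrightarrow> dim_col B = dim_row C \<Longrightarrow>
    (A + B) * C = A * C + B * C"
  for A B C :: "real mat"
  by (rule add_mult_distrib_mat) auto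

lemma mult_add_dim: "dim_row B = dim_row C \<Longrightarrow> dim_col B = dim_col C \<Longrightarrow> dim_col A = dim_row C \<Longrightarrow>
    A * (B + C) = A * B + A * C"
  for A B C :: "real mat"
  by (rule mult_add_distrib_mat) auto

lemma minus_mult_dim: "dim_row A = dim_row B \<Longrightarrow> dim_col A = dim_col B \<Longrightarrow> dim_col B = dim_row C \<Longrightarrow>
    (A - B) * C = A * C - B * C"
  for A B C :: "real mat"
  by (rule minus_mult_distrib_mat) auto

lemma mult_minus_dim: "dim_row B = dim_row C \<Longrightarrow> dim_col B = dim_col C \<Longrightarrow> dim_col A = dim_row C \<Longrightarrow>
    A * (B - C) = A * B - A * C"
  for A B C :: "real mat"
  by (rule mult_minus_distrib_mat) auto

lemma uminus_mult_dim: "dim_col A = dim_row B \<Longrightarrow> - A * B = - (A * B)"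
  for A B :: "real mat"
  by (intro eq_matI) auto

lemma mult_uminus_dim: "dim_col A = dim_row B \<Longrightarrow> A * - B = - (A * B)"
  for A B :: "real mat"
  by (intro eq_matI) auto

lemma mult_smult_dim: "dim_col A = dim_row B \<Longrightarrow> A * (c \<cdot>\<^sub>m B) = c \<cdot>\<^sub>m (A * B)"
  for A B :: "real mat"
  by (intro eq_matI) auto

lemma smult_mult_dim: "dim_col A = dim_row B \<Longrightarrow> (c \<cdot>\<^sub>m A) * B = c \<cdot>\<^sub>m (A * B)"
  for A B :: "real mat"
  by (intro eq_matI) auto

lemma one_mult_dim: "dim_row A = n \<Longrightarrow> 1\<^sub>m n * A = A"
  for A :: "real mat" by (rule left_mult_one_mat) auto

lemma mult_one_dim: "dim_col A = n \<Longrightarrow> A * 1\<^sub>m n = A"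
  for A :: "real mat" by (rule right_mult_one_mat) auto

lemma zero_mult_dim: "dim_row A = n \<Longrightarrow> 0\<^sub>m k n * A = 0\<^sub>m k (dim_col A)"
  for A :: "real mat" by (rule left_mult_zero_mat) auto

lemma mult_zero_dim: "dim_col A = n \<Longrightarrow> A * 0\<^sub>m n k = 0\<^sub>m (dim_row A) k"
  for A :: "real mat" by (rule right_mult_zero_mat) auto

lemma zero_add_dim: "dim_row A = a \<Longrightarrow> dim_col A = b \<Longrightarrow> 0\<^sub>m a b + A = A"
  for A :: "real mat" by (rule left_add_zero_mat) auto

lemma add_zero_dim: "dim_row A = a \<Longrightarrow> dim_col A = b \<Longrightarrow> A + 0\<^sub>m a b = A"
  for A :: "real mat" by (rule right_add_zero_mat) auto

lemma transpose_mult_dim: "dim_col A = dim_row B \<Longrightarrow> transpose_mat (A * B) = transpose_mat B * transpose_mat A"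
  for A B :: "real mat" by (rule transpose_mult) auto

lemma transpose_minus_dim: "dim_row A = dim_row B \<Longrightarrow> dim_col A = dim_col B \<Longrightarrow>
   transpose_mat (A - B) = transpose_mat A - transpose_mat B"
  for A B :: "real mat" by (intro eq_matI) auto

lemma transpose_add_dim: "dim_row A = dim_row B \<Longrightarrow> dim_col A = dim_col B \<Longrightarrow>
   transpose_mat (A + B) = transpose_mat A + transpose_mat B"
  for A B :: "real mat" by (intro eq_matI) auto

text \<open>Products are normalised to the right, so an inverse pair $PQ = I$ occurs as the head of
$P(QZ)$; this form lets the simplifier cancel it there.\<close>

lemma left_cancel_dim: "P * Q = 1\<^sub>m k \<Longrightarrow> dim_col P = dim_row Q \<Longrightarrow> dim_col Q = dim_row Z \<Longrightarrow> P * (Q * Z) = Z"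
  for P Q Z :: "real mat"
  by (metis index_mult_mat(3) index_one_mat(3) mult_assoc_dim one_mult_dim)

lemmas mat_expand = mult_assoc_dim add_mult_dim mult_add_dim minus_mult_dim mult_minus_dim
  uminus_mult_dim mult_uminus_dim mult_smult_dim smult_mult_dim one_mult_dim mult_one_dim
  zero_mult_dim mult_zero_dim zero_add_dim add_zero_dim transpose_mult_dim transpose_minus_dim transpose_add_dim

section \<open>Spectral theorem for real symmetric matrices\<close>

text \<open>A complex eigenvalue $z$ exists by the fundamental theorem of algebra.  Writing its eigenvector as
$x + \mathrm{i}y$ and comparing $y^T A x$ with $x^T A y$ gives $\mathrm{Im}\,z\,(x^Tx + y^Ty) = 0$.
Hence $z$ is real, and whichever of $x$, $y$ is nonzero is a real eigenvector.\<close>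

lemma symmetric_eigenvector:
  fixes A :: "real mat"
  assumes A: "A \<in> carrier_mat n n" and sym: "transpose_mat A = A" and n: "n > 0"
  obtains e v where "v \<in> carrier_vec n" "v \<bullet> v = 1" "A *\<^sub>v v = e \<cdot>\<^sub>v v"
proof -
  let ?A = "map_mat complex_of_real A"
  have cA: "?A \<in> carrier_mat n n" using A by simp
  obtain as where as: "char_poly ?A = (\<Prod>a\<leftarrow>as. [:- a, 1:])" and len: "length as = n"
    using char_poly_factorized[OF cA] by blast
  from len n obtain z where "z \<in> set as" by (cases as) auto
  then have "poly (char_poly ?A) z = 0" unfolding as by (rule linear_poly_root)
  then obtain w where w: "w \<in> carrier_vec n" "w \<noteq> 0\<^sub>v n" and ev: "?A *\<^sub>v w = z \<cdot>\<^sub>v w"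
    using cA unfolding eigenvalue_root_char_poly[OF cA, symmetric] eigenvalue_def eigenvector_def
    by auto
  define x where "x = map_vec Re w"
  define y where "y = map_vec Im w"
  have xy: "x \<in> carrier_vec n" "y \<in> carrier_vec n" unfolding x_def y_def using w by auto
  have eq: "(\<Sum>j<n. complex_of_real (A $$ (i,j)) * w $ j) = z * w $ i" if i: "i < n" for i
    using arg_cong[OF ev, of "\<lambda>u. u $ i"] w A i
    by (simp add: scalar_prod_def atLeast0LessThan)
  have Ax: "A *\<^sub>v x = Re z \<cdot>\<^sub>v x - Im z \<cdot>\<^sub>v y"
  proof (rule eq_vecI)
    fix i assume "i < dim_vec (Re z \<cdot>\<^sub>v x - Im z \<cdot>\<^sub>v y)"
    then have i: "i < n" using xy by simp
    show "(A *\<^sub>v x) $ i = (Re z \<cdot>\<^sub>v x - Im z \<cdot>\<^sub>v y) $ i"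
      using arg_cong[OF eq[OF i], of Re] i w A xy
      by (simp add: scalar_prod_def atLeast0LessThan x_def y_def)
  qed (use A xy in auto)
  have Ay: "A *\<^sub>v y = Im z \<cdot>\<^sub>v x + Re z \<cdot>\<^sub>v y"
  proof (rule eq_vecI)
    fix i assume "i < dim_vec (Im z \<cdot>\<^sub>v x + Re z \<cdot>\<^sub>v y)"
    then have i: "i < n" using xy by simp
    show "(A *\<^sub>v y) $ i = (Im z \<cdot>\<^sub>v x + Re z \<cdot>\<^sub>v y) $ i"
      using arg_cong[OF eq[OF i], of Im] i w A xy
      by (simp add: scalar_prod_def atLeast0LessThan x_def y_def algebra_simps)
  qed (use A xy in auto)
  have nz: "x \<noteq> 0\<^sub>v n \<or> y \<noteq> 0\<^sub>v n"
  proof (rule ccontr)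
    assume "\<not> ?thesis"
    then have "\<And>i. i < n \<Longrightarrow> x $ i = 0" "\<And>i. i < n \<Longrightarrow> y $ i = 0" by auto
    then have "w = 0\<^sub>v n"
      by (intro eq_vecI) (use w in \<open>auto simp: x_def y_def complex_eq_iff\<close>)
    with w show False by simp
  qed
  have pos: "0 \<le> u \<bullet> u" for u :: "real vec"
    by (simp add: scalar_prod_def sum_nonneg)
  have pos': "0 < u \<bullet> u" if "u \<in> carrier_vec n" "u \<noteq> 0\<^sub>v n" for u :: "real vec"
    using conjugate_square_greater_0_vec[OF that(1)] that(2) by simp
  have "y \<bullet> (A *\<^sub>v x) = x \<bullet> (A *\<^sub>v y)"
    using transpose_vec_mult_scalar[OF A xy] sym A xy comm_scalar_prod[of "A *\<^sub>v y" n x] by simp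
  then have "Im z * (x \<bullet> x + y \<bullet> y) = 0"
    using xy comm_scalar_prod[OF xy] unfolding Ax Ay
    by (simp add: scalar_prod_add_distrib[of _ n] scalar_prod_minus_distrib[of _ n] algebra_simps)
  moreover have "x \<bullet> x + y \<bullet> y > 0" using nz pos'[of x] pos'[of y] pos[of x] pos[of y] xy by force
  ultimately have b: "Im z = 0" by simp
  have "\<exists>u. u \<in> carrier_vec n \<and> u \<noteq> 0\<^sub>v n \<and> A *\<^sub>v u = Re z \<cdot>\<^sub>v u"
  proof (cases "x = 0\<^sub>v n")
    case True
    with nz have "y \<noteq> 0\<^sub>v n" by simp
    moreover have "A *\<^sub>v y = Re z \<cdot>\<^sub>v y" unfolding Ay using b xy by (intro eq_vecI) auto
    ultimately show ?thesis using xy by blast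
  next
    case False
    moreover have "A *\<^sub>v x = Re z \<cdot>\<^sub>v x" unfolding Ax using b xy by (intro eq_vecI) auto
    ultimately show ?thesis using xy by blast
  qed
  then obtain u where u: "u \<in> carrier_vec n" "u \<noteq> 0\<^sub>v n" "A *\<^sub>v u = Re z \<cdot>\<^sub>v u" by blast
  define v where "v = (1 / sqrt (u \<bullet> u)) \<cdot>\<^sub>v u"
  have "v \<bullet> v = 1" unfolding v_def using pos'[OF u(1,2)] u(1)
    by (simp add: real_sqrt_mult[symmetric] field_simps)
  moreover have "A *\<^sub>v v = Re z \<cdot>\<^sub>v v" unfolding v_def mult_mat_vec[OF A u(1)] u(3)
    by (intro eq_vecI) auto
  ultimately show thesis using that[of v "Re z"] u(1) by (simp add: v_def)
qed

text \<open>The reflection that exchanges $e_0$ and the unit vector $v$, written $I - uu^T/u_0$ with $u = e_0 - v$;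
the usual factor $2/(u^Tu)$ equals $1/u_0$ because $u^Tu = 2 - 2v_0 = 2u_0$.  For $v = e_0$ the
convention $x/0 = 0$ turns the formula into the identity, as it should.\<close>

definition householder :: "nat \<Rightarrow> real vec \<Rightarrow> real mat" where
  "householder n v = (let u = unit_vec n 0 - v in
     mat n n (\<lambda>(i,j). (if i = j then 1 else 0) - u $ i * u $ j / u $ 0))"

lemma householder:
  fixes v :: "real vec"
  assumes v: "v \<in> carrier_vec n" "v \<bullet> v = 1" and n: "0 < n"
  shows "householder n v \<in> carrier_mat n n"
    "transpose_mat (householder n v) = householder n v"
    "householder n v * householder n v = 1\<^sub>m n"
    "col (householder n v) 0 = v"
proof -
  define u where "u = unit_vec n 0 - v"
  let ?H = "householder n v"
  have H: "?H = mat n n (\<lambda>(i,j). (if i = j then 1 else 0) - u $ i * u $ j / u $ 0)"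
    unfolding householder_def u_def Let_def ..
  show c: "?H \<in> carrier_mat n n" unfolding H by simp
  show "transpose_mat ?H = ?H" unfolding H by (intro eq_matI) auto
  have ud: "u $ i = (if i = 0 then 1 else 0) - v $ i" if "i < n" for i
    unfolding u_def using that v n by (simp add: unit_vec_def)
  have vv: "(\<Sum>k<n. v $ k * v $ k) = 1"
    using v by (simp add: scalar_prod_def atLeast0LessThan)
  have "(\<Sum>k<n. u $ k * u $ k) = (\<Sum>k<n. (if k = 0 then 1 - 2 * v $ k else 0) + v $ k * v $ k)"
    by (rule sum.cong) (auto simp: ud algebra_simps)
  also have "\<dots> = 1 - 2 * v $ 0 + 1"
    unfolding sum.distrib vv using n by (simp add: sum.delta)
  also have "\<dots> = 2 * u $ 0" using ud[OF n] by simp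
  finally have uu: "(\<Sum>k<n. u $ k * u $ k) = 2 * u $ 0" .
  have u0: "u $ i = 0" if "u $ 0 = 0" "i < n" for i
  proof -
    have "(\<Sum>k<n. u $ k * u $ k) = 0" using uu that by simp
    then have "\<forall>k\<in>{..<n}. u $ k * u $ k = 0" by (subst sum_nonneg_eq_0_iff[symmetric]) auto
    then show ?thesis using that by auto
  qed
  show "?H * ?H = 1\<^sub>m n"
  proof (rule eq_matI)
    fix i j assume "i < dim_row (1\<^sub>m n :: real mat)" "j < dim_col (1\<^sub>m n :: real mat)"
    then have i: "i < n" and j: "j < n" by auto
    have "(?H * ?H) $$ (i,j) = (\<Sum>k<n. ((if i = k then 1 else 0) - u $ i * u $ k / u $ 0) *
         ((if k = j then 1 else 0) - u $ k * u $ j / u $ 0))"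
      using i j unfolding H by (simp add: scalar_prod_def atLeast0LessThan)
    also have "\<dots> = (\<Sum>k<n. (if i = k then (if k = j then 1 else 0) - u $ k * u $ j / u $ 0 else 0)
        - (if k = j then u $ i * u $ k / u $ 0 else 0)
        + (u $ i * u $ j / (u $ 0 * u $ 0)) * (u $ k * u $ k))"
      by (rule sum.cong) (auto simp: algebra_simps)
    also have "\<dots> = (if i = j then 1 else 0) - u $ i * u $ j / u $ 0 - u $ i * u $ j / u $ 0
        + (u $ i * u $ j / (u $ 0 * u $ 0)) * (2 * u $ 0)"
      unfolding sum.distrib sum_subtractf sum_distrib_left[symmetric] uu using i j by simp
    also have "\<dots> = (if i = j then 1 else 0)"
      using u0[OF _ i] by (cases "u $ 0 = 0") (auto simp: field_simps)
    finally show "(?H * ?H) $$ (i,j) = 1\<^sub>m n $$ (i,j)" using i j by simp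
  qed (use c in auto)
  show "col ?H 0 = v"
  proof (rule eq_vecI)
    fix i assume "i < dim_vec v"
    then have i: "i < n" using v by simp
    have "col ?H 0 $ i = (if i = 0 then 1 else 0) - u $ i * u $ 0 / u $ 0"
      unfolding H using i n by simp
    also have "\<dots> = v $ i"
      using u0[OF _ i] ud[OF i] by (cases "u $ 0 = 0") auto
    finally show "col ?H 0 $ i = v $ i" .
  qed (use c v in auto)
qed

text \<open>Deflation: a reflection $H$ carrying $e_0$ to a unit eigenvector makes $HAH$ block diagonal with a
$1 \times 1$ leading block, and the induction hypothesis diagonalises the remaining block.\<close>

theorem real_spectral_theorem:
  fixes A :: "real mat"
  assumes "A \<in> carrier_mat n n" and "transpose_mat A = A"
  shows "\<exists>Q d. orthogonal_matrix n Q \<and> A = Q * mat_diag n d * transpose_mat Q"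
  using assms
proof (induction n arbitrary: A)
  case 0
  then show ?case
    by (intro exI[of _ "1\<^sub>m 0"] exI) (auto simp: orthogonal_matrix_def intro!: eq_matI)
next
  case (Suc k)
  note A = Suc.prems(1) and sym = Suc.prems(2)
  let ?n = "Suc k"
  obtain e v where v: "v \<in> carrier_vec ?n" "v \<bullet> v = 1" and Av: "A *\<^sub>v v = e \<cdot>\<^sub>v v"
    by (rule symmetric_eigenvector[OF A sym zero_less_Suc])
  define H where "H = householder ?n v"
  note H = householder[OF v zero_less_Suc, folded H_def]
  have [simp]: "dim_row H = ?n" "dim_col H = ?n" "dim_row A = ?n" "dim_col A = ?n" using H A by auto
  define B where "B = H * A * H"
  have [simp]: "dim_row B = ?n" "dim_col B = ?n" by (auto simp: B_def)
  have symB: "transpose_mat B = B" unfolding B_def by (simp add: mat_expand H sym)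
  have "col B 0 = H *\<^sub>v (A *\<^sub>v v)"
    unfolding B_def
    by (subst col_mult2[of _ ?n ?n _ ?n]) (use H A v in \<open>auto intro!: assoc_mult_mat_vec\<close>)
  also have "\<dots> = e \<cdot>\<^sub>v (H *\<^sub>v v)" unfolding Av using H v by (intro mult_mat_vec) auto
  also have "H *\<^sub>v v = col (H * H) 0" using H by (subst col_mult2[of _ ?n ?n _ ?n]) auto
  also have "\<dots> = unit_vec ?n 0" unfolding H by simp
  finally have colB: "B $$ (i,0) = (if i = 0 then e else 0)" if "i < ?n" for i
    using that by (auto simp: index_col[symmetric] simp del: index_col)
  have rowB: "B $$ (0,i) = (if i = 0 then e else 0)" if "i < ?n" for i
    using colB[OF that] that symB by (metis \<open>dim_row B = Suc k\<close> \<open>dim_col B = Suc k\<close> index_transpose_mat(1) zero_less_Suc)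
  define C where "C = mat k k (\<lambda>(i,j). B $$ (Suc i, Suc j))"
  have "C \<in> carrier_mat k k" by (simp add: C_def)
  moreover have "transpose_mat C = C"
  proof (rule eq_matI)
    fix i j assume "i < dim_row C" "j < dim_col C"
    then show "transpose_mat C $$ (i,j) = C $$ (i,j)"
      using arg_cong[OF symB, of "\<lambda>M. M $$ (Suc i, Suc j)"] by (simp add: C_def)
  qed (auto simp: C_def)
  ultimately obtain P d where P: "orthogonal_matrix k P" and C: "C = P * mat_diag k d * transpose_mat P"
    using Suc.IH by blast
  have Pc: "P \<in> carrier_mat k k" and PP: "transpose_mat P * P = 1\<^sub>m k" "P * transpose_mat P = 1\<^sub>m k"
    using P by (auto simp: orthogonal_matrix_def)
  let ?I = "1\<^sub>m 1 :: real mat"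
  let ?blk = "\<lambda>x M. four_block_mat x (0\<^sub>m 1 k) (0\<^sub>m k 1) (M :: real mat)"
  define d' where "d' i = (case i of 0 \<Rightarrow> e | Suc j \<Rightarrow> d j)" for i
  have blk: "?blk x M * ?blk y N = ?blk (x * y) (M * N)"
    if "x \<in> carrier_mat 1 1" "y \<in> carrier_mat 1 1" "M \<in> carrier_mat k k" "N \<in> carrier_mat k k" for x y M N
    by (subst mult_four_block_mat[of _ 1 1 _ k _ k _ _ 1 _ k])
      (use that in \<open>auto simp: left_mult_zero_mat right_mult_zero_mat\<close>)
  have Bblk: "B = ?blk (e \<cdot>\<^sub>m ?I) C"
  proof (rule eq_matI)
    fix i j assume "i < dim_row (?blk (e \<cdot>\<^sub>m ?I) C)" "j < dim_col (?blk (e \<cdot>\<^sub>m ?I) C)"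
    then have "i < ?n" "j < ?n" by (auto simp: C_def)
    then show "B $$ (i,j) = ?blk (e \<cdot>\<^sub>m ?I) C $$ (i,j)"
      using colB[of i] rowB[of j] by (cases i; cases j) (auto simp: C_def)
  qed (auto simp: C_def)
  have dblk: "mat_diag ?n d' = ?blk (e \<cdot>\<^sub>m ?I) (mat_diag k d)"
    by (rule eq_matI) (auto simp: mat_diag_def d'_def split: nat.splits)
  define R where "R = ?blk ?I P"
  have Rt: "transpose_mat R = ?blk ?I (transpose_mat P)"
    unfolding R_def using Pc by (subst transpose_four_block_mat[of _ 1 1 _ k _ k]) auto
  have Rc: "R \<in> carrier_mat ?n ?n" unfolding R_def using Pc by auto
  then have [simp]: "dim_row R = ?n" "dim_col R = ?n" by auto
  have one: "?blk ?I (1\<^sub>m k) = 1\<^sub>m ?n" using four_block_one_mat[of 1 k] by simp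
  have RR: "transpose_mat R * R = 1\<^sub>m ?n" "R * transpose_mat R = 1\<^sub>m ?n"
    unfolding Rt unfolding R_def by (subst blk; use Pc in \<open>simp add: PP one\<close>)+
  have BR: "B = R * mat_diag ?n d' * transpose_mat R"
  proof -
    let ?D = "mat_diag k d"
    have "R * mat_diag ?n d' = ?blk (?I * (e \<cdot>\<^sub>m ?I)) (P * ?D)"
      unfolding R_def dblk by (rule blk) (use Pc in auto)
    moreover have "?blk (?I * (e \<cdot>\<^sub>m ?I)) (P * ?D) * transpose_mat R
        = ?blk (?I * (e \<cdot>\<^sub>m ?I) * ?I) (P * ?D * transpose_mat P)"
      unfolding Rt by (rule blk) (use Pc in \<open>auto intro!: mult_carrier_mat\<close>)
    moreover have "?I * (e \<cdot>\<^sub>m ?I) * ?I = e \<cdot>\<^sub>m ?I" by (simp add: mat_expand)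
    ultimately have "R * mat_diag ?n d' * transpose_mat R = ?blk (e \<cdot>\<^sub>m ?I) (P * ?D * transpose_mat P)"
      by simp
    then show ?thesis unfolding Bblk C by simp
  qed
  have [simp]: "dim_row (mat_diag ?n d') = ?n" "dim_col (mat_diag ?n d') = ?n"
    by (auto simp: mat_diag_def)
  note canc = left_cancel_dim[OF H(3)] left_cancel_dim[OF RR(1)] left_cancel_dim[OF RR(2)]
  have "orthogonal_matrix ?n (H * R)"
    unfolding orthogonal_matrix_def by (auto simp: mat_expand H RR canc)
  moreover have "A = H * B * H"
    unfolding B_def by (simp add: mat_expand H canc)
  then have "A = (H * R) * mat_diag ?n d' * transpose_mat (H * R)"
    unfolding BR by (simp add: mat_expand H)
  ultimately show ?case by blast
qed

section \<open>Inverses and square roots of positive matrices\<close>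

lemma mat_inv:
  assumes A: "A \<in> carrier_mat n n" and d: "det A \<noteq> 0"
  shows "mat_inv A \<in> carrier_mat n n" "A * mat_inv A = 1\<^sub>m n" "mat_inv A * A = 1\<^sub>m n"
proof -
  have "mat_inverse A \<noteq> None"
    using mat_inverse(1)[OF A, where b = "()"] det_non_zero_imp_unit[OF A d, where b = "()"] by blast
  then obtain B where "mat_inverse A = Some B" by auto
  with mat_inverse(2)[OF A this] 
  show "mat_inv A \<in> carrier_mat n n" "A * mat_inv A = 1\<^sub>m n" "mat_inv A * A = 1\<^sub>m n"
    by (auto simp: mat_inv_def)
qed

lemma mat_inv_unique:
  assumes A: "A \<in> carrier_mat n n" and B: "B \<in> carrier_mat n n" and AB: "A * B = 1\<^sub>m n"
  shows "mat_inv A = B"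
proof -
  have "det A * det B = 1" using det_mult[OF A B] AB by simp
  then have "det A \<noteq> 0" by auto
  note inv = mat_inv[OF A this]
  have "mat_inv A = mat_inv A * (A * B)" using inv A B AB by simp
  also have "\<dots> = (mat_inv A * A) * B" using inv(1) A B by simp
  also have "\<dots> = B" using inv B by simp
  finally show ?thesis .
qed

lemma spd_imp_sym_psd: "spd n A \<Longrightarrow> sym_psd n A"
proof -
  assume A: "spd n A"
  have "0 \<le> v \<bullet> (A *\<^sub>v v)" if v: "v \<in> carrier_vec n" for v
    using A v by (cases "v = 0\<^sub>v n") (auto simp: spd_def intro: less_imp_le)
  then show ?thesis using A by (simp add: spd_def sym_psd_def)
qed

lemma spd_det:
  assumes "spd n A"
  shows "det A \<noteq> 0"
proof
  assume "det A = 0"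
  then obtain v where v: "v \<in> carrier_vec n" "v \<noteq> 0\<^sub>v n" "A *\<^sub>v v = 0\<^sub>v n"
    using assms det_0_iff_vec_prod_zero[of A n] by (auto simp: spd_def)
  then have "0 < v \<bullet> (A *\<^sub>v v)" using assms by (auto simp: spd_def)
  then show False using v by simp
qed

lemma sym_psd_congruence:
  assumes A: "sym_psd n A" and P: "P \<in> carrier_mat n k"
  shows "sym_psd k (transpose_mat P * A * P)"
proof -
  have Ac: "A \<in> carrier_mat n n" and At: "transpose_mat A = A" using A by (auto simp: sym_psd_def)
  have d: "dim_row A = n" "dim_col A = n" "dim_row P = n" "dim_col P = k" using Ac P by auto
  have "0 \<le> v \<bullet> (transpose_mat P * A * P *\<^sub>v v)" if v: "v \<in> carrier_vec k" for v
  proof -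
    have Pv: "P *\<^sub>v v \<in> carrier_vec n" using P v by simp
    have APv: "A *\<^sub>v (P *\<^sub>v v) \<in> carrier_vec n" using Ac Pv by simp
    have "transpose_mat P * A * P *\<^sub>v v = transpose_mat P * A *\<^sub>v (P *\<^sub>v v)"
      by (rule assoc_mult_mat_vec[of _ k n _ k]) (use Ac P v in auto)
    also have "\<dots> = transpose_mat P *\<^sub>v (A *\<^sub>v (P *\<^sub>v v))"
      by (rule assoc_mult_mat_vec[of _ k n _ n]) (use Ac P Pv in auto)
    finally have "v \<bullet> (transpose_mat P * A * P *\<^sub>v v) = (transpose_mat P *\<^sub>v (A *\<^sub>v (P *\<^sub>v v))) \<bullet> v"
      using comm_scalar_prod[of v k "transpose_mat P *\<^sub>v (A *\<^sub>v (P *\<^sub>v v))"] v P APv by simp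
    also have "\<dots> = (A *\<^sub>v (P *\<^sub>v v)) \<bullet> (P *\<^sub>v v)"
      by (rule transpose_vec_mult_scalar[OF P v APv])
    also have "\<dots> = (P *\<^sub>v v) \<bullet> (A *\<^sub>v (P *\<^sub>v v))"
      by (rule comm_scalar_prod[OF APv Pv])
    finally have "v \<bullet> (transpose_mat P * A * P *\<^sub>v v) = (P *\<^sub>v v) \<bullet> (A *\<^sub>v (P *\<^sub>v v))" .
    then show ?thesis using A Pv by (simp add: sym_psd_def)
  qed
  then show ?thesis unfolding sym_psd_def using d At by (auto simp: mat_expand)
qed

lemma sym_psd_diag_nonneg:
  assumes A: "sym_psd n A" and i: "i < n"
  shows "0 \<le> A $$ (i,i)"
proof -
  have Ac: "A \<in> carrier_mat n n" using A by (auto simp: sym_psd_def)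
  have "0 \<le> unit_vec n i \<bullet> (A *\<^sub>v unit_vec n i)" using A by (simp add: sym_psd_def)
  also have "\<dots> = A $$ (i,i)" using Ac i by (simp add: scalar_prod_left_unit)
  finally show ?thesis .
qed

lemma transpose_mat_diag: "transpose_mat (mat_diag n f) = mat_diag n f"
  by (rule eq_matI) (auto simp: mat_diag_def)

lemma sym_psd_mat_diag:
  assumes "\<And>i. i < n \<Longrightarrow> 0 \<le> f i"
  shows "sym_psd n (mat_diag n f :: real mat)"
proof -
  have "0 \<le> v \<bullet> (mat_diag n f *\<^sub>v v)" if v: "v \<in> carrier_vec n" for v
  proof -
    have "(mat_diag n f *\<^sub>v v) $ i = f i * v $ i" if i: "i < n" for i
    proof -
      have "(mat_diag n f *\<^sub>v v) $ i = (\<Sum>j<n. (if i = j then f j else 0) * v $ j)"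
        using i v by (simp add: mat_diag_def scalar_prod_def atLeast0LessThan)
      also have "\<dots> = (\<Sum>j<n. if j = i then f j * v $ j else 0)"
        by (rule sum.cong) auto
      finally have "(mat_diag n f *\<^sub>v v) $ i = (\<Sum>j<n. if j = i then f j * v $ j else 0)" .
      then show ?thesis using i by simp
    qed
    then have "v \<bullet> (mat_diag n f *\<^sub>v v) = (\<Sum>i<n. v $ i * (f i * v $ i))"
      by (auto simp: scalar_prod_def atLeast0LessThan mat_diag_def intro!: sum.cong)
    also have "\<dots> \<ge> 0"
      using assms by (intro sum_nonneg) (auto simp: mult.left_commute)
    finally show ?thesis .
  qed
  then show ?thesis by (auto simp: sym_psd_def transpose_mat_diag)
qed

lemma psd_sqrt_exists:
  assumes A: "sym_psd n A"
  shows "\<exists>R. sym_psd n R \<and> R * R = A"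
proof -
  have Ac: "A \<in> carrier_mat n n" "transpose_mat A = A" using A by (auto simp: sym_psd_def)
  obtain Q d where Q: "orthogonal_matrix n Q" and AQ: "A = Q * mat_diag n d * transpose_mat Q"
    using real_spectral_theorem[OF Ac] by blast
  have [simp]: "dim_row Q = n" "dim_col Q = n" and QQ: "transpose_mat Q * Q = 1\<^sub>m n" and Qc: "Q \<in> carrier_mat n n"
    using Q by (auto simp: orthogonal_matrix_def)
  have [simp]: "dim_row (mat_diag n f) = n" "dim_col (mat_diag n f) = n" for f :: "nat \<Rightarrow> real"
    by (auto simp: mat_diag_def)
  have "transpose_mat Q * A * Q = mat_diag n d"
    unfolding AQ by (simp add: mat_expand QQ left_cancel_dim[OF QQ])
  with sym_psd_congruence[OF A Qc] have "sym_psd n (mat_diag n d)" by simp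
  from sym_psd_diag_nonneg[OF this] have d: "0 \<le> d i" if "i < n" for i
    using that by (simp add: mat_diag_def)
  have dd: "mat_diag n (\<lambda>i. sqrt (d i) * sqrt (d i)) = mat_diag n d"
    by (rule eq_matI) (auto simp: mat_diag_def d)
  let ?S = "mat_diag n (\<lambda>i. sqrt (d i))"
  have "sym_psd n (transpose_mat (transpose_mat Q) * ?S * transpose_mat Q)"
    using Qc d by (intro sym_psd_congruence[OF sym_psd_mat_diag]) auto
  moreover have "(Q * ?S * transpose_mat Q) * (Q * ?S * transpose_mat Q)
      = Q * (?S * ?S) * transpose_mat Q"
    by (simp add: mat_expand left_cancel_dim[OF QQ] del: mat_diag_diag)
  then have "(Q * ?S * transpose_mat Q) * (Q * ?S * transpose_mat Q) = A"
    unfolding AQ mat_diag_diag dd .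
  ultimately show ?thesis unfolding transpose_transpose by blast
qed

text \<open>Put $E = R - T$.  Then $RE + ET = R^2 - T^2 = 0$.  In an orthonormal eigenbasis of $E$, with
eigenvalues $d_i$, the diagonal of this equation reads $d_i(R_{ii} + T_{ii}) = 0$, while
$d_i = R_{ii} - T_{ii}$.  As the diagonal entries of positive semi-definite matrices are non-negative,
every $d_i$ vanishes.\<close>

lemma psd_sqrt_unique:
  assumes R: "sym_psd n R" and T: "sym_psd n T" and eq: "R * R = T * T"
  shows "R = T"
proof -
  have [simp]: "dim_row R = n" "dim_col R = n" "dim_row T = n" "dim_col T = n"
    and tr: "transpose_mat R = R" "transpose_mat T = T"
    using R T by (auto simp: sym_psd_def)
  define E where "E = R - T"
  have Ec: "E \<in> carrier_mat n n" "transpose_mat E = E"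
    unfolding E_def by (auto simp: transpose_minus_dim tr intro!: carrier_matI)
  obtain Q d where Q: "orthogonal_matrix n Q" and EQ: "E = Q * mat_diag n d * transpose_mat Q"
    using real_spectral_theorem[OF Ec] by blast
  have [simp]: "dim_row Q = n" "dim_col Q = n" and Qc: "Q \<in> carrier_mat n n"
    and QQ: "transpose_mat Q * Q = 1\<^sub>m n" "Q * transpose_mat Q = 1\<^sub>m n"
    using Q by (auto simp: orthogonal_matrix_def)
  have [simp]: "dim_row (mat_diag n f) = n" "dim_col (mat_diag n f) = n" for f :: "nat \<Rightarrow> real"
    by (auto simp: mat_diag_def)
  note canc = left_cancel_dim[OF QQ(1)] left_cancel_dim[OF QQ(2)]
  let ?D = "mat_diag n d"
  define R' where "R' = transpose_mat Q * R * Q"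
  define T' where "T' = transpose_mat Q * T * Q"
  have [simp]: "dim_row R' = n" "dim_col R' = n" "dim_row T' = n" "dim_col T' = n"
    by (auto simp: R'_def T'_def)
  have psd: "sym_psd n R'" "sym_psd n T'"
    unfolding R'_def T'_def using sym_psd_congruence R T Qc by auto
  have D: "?D = transpose_mat Q * E * Q" unfolding EQ by (simp add: mat_expand canc QQ)
  have diff: "R' - T' = ?D" unfolding D R'_def T'_def E_def by (simp add: mat_expand)
  have "R' * ?D + ?D * T' = transpose_mat Q * (R * E + E * T) * Q"
    unfolding D unfolding R'_def T'_def by (simp add: mat_expand canc E_def)
  also have "R * E + E * T = 0\<^sub>m n n"
    unfolding E_def by (simp add: mat_expand eq) (rule eq_matI, auto)
  finally have sylv: "R' * ?D + ?D * T' = 0\<^sub>m n n" by (simp add: mat_expand)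
  have d0: "d i = 0" if i: "i < n" for i
  proof -
    have "(R' * ?D) $$ (i,i) = R' $$ (i,i) * d i"
      using i by (subst mat_diag_mult_right[of _ n]) auto
    moreover have "(?D * T') $$ (i,i) = d i * T' $$ (i,i)"
      using i by (subst mat_diag_mult_left[of _ n n]) auto
    ultimately have "d i * (R' $$ (i,i) + T' $$ (i,i)) = 0"
      using arg_cong[OF sylv, of "\<lambda>M. M $$ (i,i)"] i
      by (simp add: algebra_simps del: index_mult_mat(1))
    moreover have "R' $$ (i,i) - T' $$ (i,i) = d i"
      using arg_cong[OF diff, of "\<lambda>M. M $$ (i,i)"] i by (simp add: mat_diag_def)
    moreover have "0 \<le> R' $$ (i,i)" "0 \<le> T' $$ (i,i)"
      using sym_psd_diag_nonneg psd i by auto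
    ultimately show ?thesis by (auto simp: add_nonneg_eq_0_iff)
  qed
  have "?D = 0\<^sub>m n n" by (rule eq_matI) (auto simp: mat_diag_def d0)
  then have "E = 0\<^sub>m n n" unfolding EQ by (simp add: mat_expand)
  show ?thesis
  proof (rule eq_matI)
    fix i j assume "i < dim_row T" "j < dim_col T"
    then show "R $$ (i,j) = T $$ (i,j)"
      using arg_cong[OF \<open>E = 0\<^sub>m n n\<close>, of "\<lambda>M. M $$ (i,j)"] by (simp add: E_def)
  qed auto
qed

text \<open>Existence and uniqueness together give meaning to the definite description in the square root.\<close>

lemma mat_sqrt_eqI:
  assumes "sym_psd n R" "R * R = A"
  shows "mat_sqrt A = R"
proof -
  have "dim_row A = n" using assms by (auto simp: sym_psd_def)
  then show ?thesis unfolding mat_sqrt_def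
    using assms psd_sqrt_unique by (intro the_equality) auto
qed

lemma mat_sqrt:
  assumes "sym_psd n A"
  shows "sym_psd n (mat_sqrt A)" "mat_sqrt A * mat_sqrt A = A"
  using psd_sqrt_exists[OF assms] mat_sqrt_eqI by metis+

lemma mat_inv_symmetric:
  assumes A: "A \<in> carrier_mat n n" "transpose_mat A = A" "det A \<noteq> 0"
  shows "transpose_mat (mat_inv A) = mat_inv A"
proof -
  note inv = mat_inv[OF A(1,3)]
  have "A * transpose_mat (mat_inv A) = transpose_mat (mat_inv A * A)"
    using transpose_mult[OF inv(1) A(1)] A(2) by simp
  then have "A * transpose_mat (mat_inv A) = 1\<^sub>m n" using inv by simp
  then show ?thesis using mat_inv_unique[OF A(1), of "transpose_mat (mat_inv A)"] inv(1) by simp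
qed

lemma sym_psd_mat_inv:
  assumes A: "sym_psd n A" and d: "det A \<noteq> 0"
  shows "sym_psd n (mat_inv A)"
proof -
  have Ac: "A \<in> carrier_mat n n" "transpose_mat A = A" using A by (auto simp: sym_psd_def)
  note inv = mat_inv[OF Ac(1) d]
  have "mat_inv A = transpose_mat (mat_inv A) * A * mat_inv A"
    using inv Ac by (simp add: mat_inv_symmetric[OF Ac d])
  then show ?thesis using sym_psd_congruence[OF A inv(1)] by simp
qed

lemma spd_mat_sqrt:
  assumes A: "spd n A"
  shows "mat_sqrt A \<in> carrier_mat n n" "transpose_mat (mat_sqrt A) = mat_sqrt A"
    "mat_sqrt A * mat_sqrt A = A"
    "mat_inv_sqrt A \<in> carrier_mat n n" "transpose_mat (mat_inv_sqrt A) = mat_inv_sqrt A"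
    "mat_sqrt A * mat_inv_sqrt A = 1\<^sub>m n" "mat_inv_sqrt A * mat_sqrt A = 1\<^sub>m n"
proof -
  note R = mat_sqrt[OF spd_imp_sym_psd[OF A]]
  show c: "mat_sqrt A \<in> carrier_mat n n" and t: "transpose_mat (mat_sqrt A) = mat_sqrt A"
    using R by (auto simp: sym_psd_def)
  show RR: "mat_sqrt A * mat_sqrt A = A" by (rule R)
  have "det A = det (mat_sqrt A) * det (mat_sqrt A)" using det_mult[OF c c] RR by simp
  with spd_det[OF A] have d: "det (mat_sqrt A) \<noteq> 0" by auto
  note inv = mat_inv[OF c d, folded mat_inv_sqrt_def]
  show "mat_inv_sqrt A \<in> carrier_mat n n" "mat_sqrt A * mat_inv_sqrt A = 1\<^sub>m n"
    "mat_inv_sqrt A * mat_sqrt A = 1\<^sub>m n" by (rule inv)+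
  show "transpose_mat (mat_inv_sqrt A) = mat_inv_sqrt A"
    unfolding mat_inv_sqrt_def by (rule mat_inv_symmetric[OF c t d])
qed

section \<open>Three-by-three block matrices\<close>

text \<open>Rows and columns of blocks are $2 \times 2$ block matrices with empty blocks, so all products of
block matrices reduce to the multiplication rule for four blocks.\<close>

lemma beside_eq_four_block:
  assumes "P \<in> carrier_mat a b" "Q \<in> carrier_mat a c"
  shows "beside P Q = four_block_mat P Q (0\<^sub>m 0 b) (0\<^sub>m 0 c)"
  using assms unfolding beside_def append_rows_def
  by (subst transpose_four_block_mat[of _ b a _ 0 _ c]) auto

lemma append_rows_eq_four_block:
  assumes "P \<in> carrier_mat a b" "Q \<in> carrier_mat c b"
  shows "P @\<^sub>r Q = four_block_mat P (0\<^sub>m a 0) Q (0\<^sub>m c 0)"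
  using assms unfolding append_rows_def by auto

lemma beside_dims: 
  assumes "dim_row P = dim_row Q"
  shows "dim_row (beside P Q) = dim_row P" "dim_col (beside P Q) = dim_col P + dim_col Q"
  using assms unfolding beside_def append_rows_def by auto

lemma beside_carrier: "P \<in> carrier_mat a b \<Longrightarrow> Q \<in> carrier_mat a c \<Longrightarrow> beside P Q \<in> carrier_mat a (b + c)"
  by (intro carrier_matI) (auto simp: beside_dims)

lemma append_rows_mult_beside:
  assumes "P \<in> carrier_mat a k" "Q \<in> carrier_mat b k" "R \<in> carrier_mat k c" "S \<in> carrier_mat k d"
  shows "(P @\<^sub>r Q) * beside R S = four_block_mat (P * R) (P * S) (Q * R) (Q * S)"
  unfolding append_rows_eq_four_block[OF assms(1,2)] beside_eq_four_block[OF assms(3,4)]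
  by (subst mult_four_block_mat[of _ a k _ 0 _ b _ _ c _ d]) (use assms in auto)

lemma four_block_mult_append_rows:
  assumes "A \<in> carrier_mat a c" "B \<in> carrier_mat a d" "C \<in> carrier_mat b c" "D \<in> carrier_mat b d"
    "P \<in> carrier_mat c k" "Q \<in> carrier_mat d k"
  shows "four_block_mat A B C D * (P @\<^sub>r Q) = (A * P + B * Q) @\<^sub>r (C * P + D * Q)"
  unfolding append_rows_eq_four_block[OF assms(5,6)]
  by (subst append_rows_eq_four_block[of _ a k _ b], use assms in simp, use assms in simp)
    (subst mult_four_block_mat[of _ a c _ d _ b _ _ k _ 0], use assms in auto)

lemma append_rows_mult:
  assumes "P \<in> carrier_mat a k" "Q \<in> carrier_mat b k" "R \<in> carrier_mat k c"
  shows "(P @\<^sub>r Q) * R = (P * R) @\<^sub>r (Q * R)"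
proof -
  have "R = four_block_mat R (0\<^sub>m k 0) (0\<^sub>m 0 c) (0\<^sub>m 0 0)"
    using assms by (intro eq_matI) auto
  then have "(P @\<^sub>r Q) * R = four_block_mat P (0\<^sub>m a 0) Q (0\<^sub>m b 0) * four_block_mat R (0\<^sub>m k 0) (0\<^sub>m 0 c) (0\<^sub>m 0 0)"
    using append_rows_eq_four_block[OF assms(1,2)] by simp
  also have "\<dots> = four_block_mat (P * R) (0\<^sub>m a 0) (Q * R) (0\<^sub>m b 0)"
    by (subst mult_four_block_mat[of _ a k _ 0 _ b _ _ c _ 0]) (use assms in auto)
  also have "\<dots> = (P * R) @\<^sub>r (Q * R)"
    by (rule append_rows_eq_four_block[symmetric]) (use assms in auto)
  finally show ?thesis .
qed

lemma beside_mult_four_block: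
  assumes "A \<in> carrier_mat c a" "B \<in> carrier_mat c b" "C \<in> carrier_mat d a" "D \<in> carrier_mat d b"
    "P \<in> carrier_mat k c" "Q \<in> carrier_mat k d"
  shows "beside P Q * four_block_mat A B C D = beside (P * A + Q * C) (P * B + Q * D)"
  unfolding beside_eq_four_block[OF assms(5,6)]
  by (subst beside_eq_four_block[of _ k a _ b], use assms in simp, use assms in simp)
    (subst mult_four_block_mat[of _ k c _ d _ 0 _ _ a _ b], use assms in auto)

lemma mult_beside:
  assumes "P \<in> carrier_mat k a" "Q \<in> carrier_mat k b" "R \<in> carrier_mat c k"
  shows "R * beside P Q = beside (R * P) (R * Q)"
proof -
  have "R = four_block_mat R (0\<^sub>m c 0) (0\<^sub>m 0 k) (0\<^sub>m 0 0)"
    using assms by (intro eq_matI) auto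
  then have "R * beside P Q = four_block_mat R (0\<^sub>m c 0) (0\<^sub>m 0 k) (0\<^sub>m 0 0) * four_block_mat P Q (0\<^sub>m 0 a) (0\<^sub>m 0 b)"
    using beside_eq_four_block[OF assms(1,2)] by simp
  also have "\<dots> = four_block_mat (R * P) (R * Q) (0\<^sub>m 0 a) (0\<^sub>m 0 b)"
    by (subst mult_four_block_mat[of _ c k _ 0 _ 0 _ _ a _ b]) (use assms in auto)
  also have "\<dots> = beside (R * P) (R * Q)"
    by (rule beside_eq_four_block[symmetric]) (use assms in auto)
  finally show ?thesis .
qed

lemma beside_mult_append_rows:
  assumes "P \<in> carrier_mat a b" "Q \<in> carrier_mat a c" "R \<in> carrier_mat b d" "S \<in> carrier_mat c d"
  shows "beside P Q * (R @\<^sub>r S) = P * R + Q * S"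
proof -
  have "beside P Q * (R @\<^sub>r S) = four_block_mat (P * R + Q * S) (0\<^sub>m a 0) (0\<^sub>m 0 d) (0\<^sub>m 0 0)"
    unfolding append_rows_eq_four_block[OF assms(3,4)] beside_eq_four_block[OF assms(1,2)]
    by (subst mult_four_block_mat[of _ a b _ c _ 0 _ _ d _ 0]) (use assms in auto)
  also have "\<dots> = P * R + Q * S" using assms by (intro eq_matI) auto
  finally show ?thesis .
qed

lemma add_append_rows:
  assumes "P \<in> carrier_mat a c" "Q \<in> carrier_mat b c" "R \<in> carrier_mat a c" "S \<in> carrier_mat b c"
  shows "(P @\<^sub>r Q) + (R @\<^sub>r S) = (P + R) @\<^sub>r (Q + S)"
  using assms by (intro eq_matI) (auto simp: append_rows_def)

lemma add_beside:
  assumes "P \<in> carrier_mat c a" "Q \<in> carrier_mat c b" "R \<in> carrier_mat c a" "S \<in> carrier_mat c b"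
  shows "beside P Q + beside R S = beside (P + R) (Q + S)"
  using assms by (intro eq_matI) (auto simp: beside_def append_rows_def)

lemma block3_carrier:
  assumes "P11 \<in> carrier_mat n n" "P22 \<in> carrier_mat m m" "P33 \<in> carrier_mat l l"
  shows "block3 P11 P12 P13 P21 P22 P23 P31 P32 P33 \<in> carrier_mat (n + m + l) (n + m + l)"
  using assms unfolding block3_def by (intro four_block_carrier_mat)

lemma mult_block3:
  assumes P: "P11 \<in> carrier_mat n n" "P12 \<in> carrier_mat n m" "P13 \<in> carrier_mat n l"
    "P21 \<in> carrier_mat m n" "P22 \<in> carrier_mat m m" "P23 \<in> carrier_mat m l"
    "P31 \<in> carrier_mat l n" "P32 \<in> carrier_mat l m" "P33 \<in> carrier_mat l l"
    and Q: "Q11 \<in> carrier_mat n n" "Q12 \<in> carrier_mat n m" "Q13 \<in> carrier_mat n l"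
    "Q21 \<in> carrier_mat m n" "Q22 \<in> carrier_mat m m" "Q23 \<in> carrier_mat m l"
    "Q31 \<in> carrier_mat l n" "Q32 \<in> carrier_mat l m" "Q33 \<in> carrier_mat l l"
  shows "block3 P11 P12 P13 P21 P22 P23 P31 P32 P33 * block3 Q11 Q12 Q13 Q21 Q22 Q23 Q31 Q32 Q33
    = block3
       (P11 * Q11 + P12 * Q21 + P13 * Q31) (P11 * Q12 + P12 * Q22 + P13 * Q32) (P11 * Q13 + P12 * Q23 + P13 * Q33)
       (P21 * Q11 + P22 * Q21 + P23 * Q31) (P21 * Q12 + P22 * Q22 + P23 * Q32) (P21 * Q13 + P22 * Q23 + P23 * Q33)
       (P31 * Q11 + P32 * Q21 + P33 * Q31) (P31 * Q12 + P32 * Q22 + P33 * Q32) (P31 * Q13 + P32 * Q23 + P33 * Q33)"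
proof -
  let ?P = "four_block_mat P11 P12 P21 P22" and ?Q = "four_block_mat Q11 Q12 Q21 Q22"
  have "block3 P11 P12 P13 P21 P22 P23 P31 P32 P33 * block3 Q11 Q12 Q13 Q21 Q22 Q23 Q31 Q32 Q33
    = four_block_mat
       (?P * ?Q + (P13 @\<^sub>r P23) * beside Q31 Q32)
       (?P * (Q13 @\<^sub>r Q23) + (P13 @\<^sub>r P23) * Q33)
       (beside P31 P32 * ?Q + P33 * beside Q31 Q32)
       (beside P31 P32 * (Q13 @\<^sub>r Q23) + P33 * Q33)"
    unfolding block3_def
    by (rule mult_four_block_mat[of _ "n + m" "n + m" _ l _ l _ _ "n + m" _ l])
      (use P Q in \<open>auto intro!: beside_carrier\<close>)
  also have "?P * ?Q + (P13 @\<^sub>r P23) * beside Q31 Q32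
     = four_block_mat (P11 * Q11 + P12 * Q21 + P13 * Q31) (P11 * Q12 + P12 * Q22 + P13 * Q32)
         (P21 * Q11 + P22 * Q21 + P23 * Q31) (P21 * Q12 + P22 * Q22 + P23 * Q32)"
    unfolding append_rows_mult_beside[OF P(3,6) Q(7,8)] mult_four_block_mat[OF P(1,2,4,5) Q(1,2,4,5)]
    by (rule add_four_block_mat[of _ n n _ m _ m]) (use P Q in auto)
  also have "?P * (Q13 @\<^sub>r Q23) + (P13 @\<^sub>r P23) * Q33
     = (P11 * Q13 + P12 * Q23 + P13 * Q33) @\<^sub>r (P21 * Q13 + P22 * Q23 + P23 * Q33)"
    unfolding append_rows_mult[OF P(3,6) Q(9)] four_block_mult_append_rows[OF P(1,2,4,5) Q(3,6)]
    by (rule add_append_rows[of _ n l _ m]) (use P Q in auto)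
  also have "beside P31 P32 * ?Q + P33 * beside Q31 Q32
     = beside (P31 * Q11 + P32 * Q21 + P33 * Q31) (P31 * Q12 + P32 * Q22 + P33 * Q32)"
    unfolding mult_beside[OF Q(7,8) P(9)] beside_mult_four_block[OF Q(1,2,4,5) P(7,8)]
    by (rule add_beside[of _ l n _ m]) (use P Q in auto)
  also have "beside P31 P32 * (Q13 @\<^sub>r Q23) + P33 * Q33 = P31 * Q13 + P32 * Q23 + P33 * Q33"
    unfolding beside_mult_append_rows[OF P(7,8) Q(3,6)] ..
  finally show ?thesis unfolding block3_def .
qed

lemma append_rows_zero: "0\<^sub>m a c @\<^sub>r 0\<^sub>m b c = 0\<^sub>m (a + b) c"
  by (rule eq_matI) (auto simp: append_rows_def)

lemma beside_zero: "beside (0\<^sub>m c a) (0\<^sub>m c b) = 0\<^sub>m c (a + b)"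
  unfolding beside_def by (simp add: append_rows_zero)

lemma det_block3_lower:
  assumes "P11 \<in> carrier_mat n n" "P21 \<in> carrier_mat m n" "P22 \<in> carrier_mat m m"
    "P31 \<in> carrier_mat l n" "P32 \<in> carrier_mat l m" "P33 \<in> carrier_mat l l"
  shows "det (block3 P11 (0\<^sub>m n m) (0\<^sub>m n l) P21 P22 (0\<^sub>m m l) P31 P32 P33) = det P11 * det P22 * det P33"
proof -
  have "det (block3 P11 (0\<^sub>m n m) (0\<^sub>m n l) P21 P22 (0\<^sub>m m l) P31 P32 P33)
      = det (four_block_mat P11 (0\<^sub>m n m) P21 P22) * det P33"
    unfolding block3_def append_rows_zero
    by (rule det_four_block_mat_upper_right_zero[of _ "n + m" _ l])
      (use assms in \<open>auto intro!: beside_carrier\<close>)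
  also have "det (four_block_mat P11 (0\<^sub>m n m) P21 P22) = det P11 * det P22"
    by (rule det_four_block_mat_upper_right_zero[of _ n _ m]) (use assms in auto)
  finally show ?thesis .
qed

lemma det_block3_upper:
  assumes "P11 \<in> carrier_mat n n" "P12 \<in> carrier_mat n m" "P13 \<in> carrier_mat n l"
    "P22 \<in> carrier_mat m m" "P23 \<in> carrier_mat m l" "P33 \<in> carrier_mat l l"
  shows "det (block3 P11 P12 P13 (0\<^sub>m m n) P22 P23 (0\<^sub>m l n) (0\<^sub>m l m) P33) = det P11 * det P22 * det P33"
proof -
  have "det (block3 P11 P12 P13 (0\<^sub>m m n) P22 P23 (0\<^sub>m l n) (0\<^sub>m l m) P33)
      = det (four_block_mat P11 P12 (0\<^sub>m m n) P22) * det P33"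
    unfolding block3_def beside_zero
    by (rule det_four_block_mat_lower_left_zero[of _ "n + m" _ l]) (use assms in auto)
  also have "det (four_block_mat P11 P12 (0\<^sub>m m n) P22) = det P11 * det P22"
    by (rule det_four_block_mat_lower_left_zero[of _ n _ m]) (use assms in auto)
  finally show ?thesis .
qed

text \<open>The nesting of the blocks puts the third row and column apart; the characteristic polynomial
argument below needs the first row and column apart instead.\<close>

lemma block3_regroup:
  assumes "P11 \<in> carrier_mat n n" "P12 \<in> carrier_mat n m" "P13 \<in> carrier_mat n l"
    "P21 \<in> carrier_mat m n" "P22 \<in> carrier_mat m m" "P23 \<in> carrier_mat m l"
    "P31 \<in> carrier_mat l n" "P32 \<in> carrier_mat l m" "P33 \<in> carrier_mat l l"
  shows "block3 P11 P12 P13 P21 P22 P23 P31 P32 P33 =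
    four_block_mat P11 (beside P12 P13) (P21 @\<^sub>r P31) (four_block_mat P22 P23 P32 P33)"
  using assms unfolding block3_def beside_def append_rows_def
  by (intro eq_matI) (auto simp: less_diff_conv less_diff_conv2 add.commute)

section \<open>Characteristic polynomials of arrow-shaped block matrices\<close>

lemma poly_eq_off_finite:
  fixes p q :: "real poly"
  assumes "finite F" "\<And>z. z \<notin> F \<Longrightarrow> poly p z = poly q z"
  shows "p = q"
proof (rule ccontr)
  assume "p \<noteq> q"
  then have "finite {z. poly (p - q) z = 0}" by (intro poly_roots_finite) simp
  moreover have "UNIV - F \<subseteq> {z. poly (p - q) z = 0}" using assms(2) by auto
  ultimately have "finite (UNIV - F)" by (rule rev_finite_subset)
  with assms(1) show False by (simp add: infinite_UNIV_char_0)
qed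

text \<open>For $z$ outside the spectrum of the diagonal block, that block of the characteristic matrix can be
eliminated, which leaves its determinant times the determinant of the Schur complement.  The diagonal matrices
scaling the first block row and column enter the Schur complement only through their product.\<close>

lemma char_poly_arrow_eval:
  fixes U V W :: "real mat"
  assumes U: "U \<in> carrier_mat n k" and V: "V \<in> carrier_mat k n" and W: "W \<in> carrier_mat k k"
    and z: "\<And>i. i < n \<Longrightarrow> z \<noteq> d i"
  shows "poly (char_poly (four_block_mat (mat_diag n d) (mat_diag n a * U) (V * mat_diag n b) W)) z
    = det (mat_diag n (\<lambda>i. z - d i)) * 
      det (- char_matrix W z - V * mat_diag n (\<lambda>i. a i * b i / (z - d i)) * U)"
proof -
  let ?D = "mat_diag n (\<lambda>i. z - d i)"
  let ?M = "four_block_mat (mat_diag n d) (mat_diag n a * U) (V * mat_diag n b) W"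
  let ?N = "four_block_mat ?D (- (mat_diag n a * U)) (- (V * mat_diag n b)) (- char_matrix W z)"
  let ?X = "mat_diag n (\<lambda>i. a i / (z - d i)) * U"
  let ?E = "four_block_mat (1\<^sub>m n) ?X (0\<^sub>m k n) (1\<^sub>m k)"
  let ?S = "- char_matrix W z - V * mat_diag n (\<lambda>i. a i * b i / (z - d i)) * U"
  have [simp]: "dim_row U = n" "dim_col U = k" "dim_row V = k" "dim_col V = n" "dim_row W = k" "dim_col W = k"
    "dim_row (char_matrix W z) = k" "dim_col (char_matrix W z) = k"
    using U V W by (auto simp: char_matrix_def)
  have [simp]: "dim_row (mat_diag n f) = n" "dim_col (mat_diag n f) = n" for f :: "nat \<Rightarrow> real"
    by (auto simp: mat_diag_def)
  have dc: "P \<in> carrier_mat x y \<longleftrightarrow> dim_row P = x \<and> dim_col P = y" for P :: "real mat" and x y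
    unfolding carrier_mat_def mem_Collect_eq ..
  have M: "?M \<in> carrier_mat (n + k) (n + k)" by (simp add: dc)
  have "poly (char_poly ?M) z = det (- (char_matrix ?M z))" by (rule char_poly_matrix[OF M])
  also have "- (char_matrix ?M z) = ?N"
    by (rule eq_matI) (auto simp: char_matrix_def mat_diag_def simp del: index_mult_mat(1))
  also have "det ?N = det (?N * ?E)"
  proof -
    have "det ?E = 1"
      by (subst det_four_block_mat_lower_left_zero[of _ n _ k]) (auto simp: dc)
    then show ?thesis by (subst det_mult[of _ "n + k"]) (auto simp: dc)
  qed
  also have "?N * ?E = four_block_mat ?D (0\<^sub>m n k) (- (V * mat_diag n b)) ?S"
  proof -
    have e1: "mat_diag n (\<lambda>i. (z - d i) * (a i / (z - d i))) = mat_diag n a"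
      by (rule eq_matI) (use z in \<open>auto simp: mat_diag_def\<close>)
    have e2: "?D * ?X = mat_diag n a * U"
      using mult_assoc_dim[of ?D "mat_diag n (\<lambda>i. a i / (z - d i))" U, symmetric]
      by (simp add: e1 del: times_divide_eq_right)
    have e3: "V * mat_diag n b * ?X = V * mat_diag n (\<lambda>i. a i * b i / (z - d i)) * U"
    proof -
      have "V * mat_diag n b * ?X = V * (mat_diag n b * mat_diag n (\<lambda>i. a i / (z - d i))) * U"
        by (simp add: mult_assoc_dim del: mat_diag_diag)
      then show ?thesis by (simp add: mult.commute)
    qed
    have "?N * ?E = four_block_mat (?D * 1\<^sub>m n + (- (mat_diag n a * U)) * 0\<^sub>m k n)
       (?D * ?X + (- (mat_diag n a * U)) * 1\<^sub>m k)
       (- (V * mat_diag n b) * 1\<^sub>m n + (- char_matrix W z) * 0\<^sub>m k n)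
       (- (V * mat_diag n b) * ?X + (- char_matrix W z) * 1\<^sub>m k)"
      by (rule mult_four_block_mat[of _ n n _ k _ k _ _ n _ k]) (auto simp: dc)
    also have "?D * 1\<^sub>m n + (- (mat_diag n a * U)) * 0\<^sub>m k n = ?D"
      by (simp add: mat_expand)
    also have "?D * ?X + (- (mat_diag n a * U)) * 1\<^sub>m k = 0\<^sub>m n k"
      unfolding e2 by (simp add: mult_one_dim) (rule eq_matI; simp del: index_mult_mat(1))
    also have "- (V * mat_diag n b) * 1\<^sub>m n + (- char_matrix W z) * 0\<^sub>m k n = - (V * mat_diag n b)"
      by (simp add: mult_one_dim mult_zero_dim) (rule eq_matI; simp del: index_mult_mat(1))
    also have "- (V * mat_diag n b) * ?X + (- char_matrix W z) * 1\<^sub>m k = ?S"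
      by (simp add: uminus_mult_dim e3 mult_one_dim) (rule eq_matI; simp del: index_mult_mat(1))
    finally show ?thesis .
  qed
  also have "det \<dots> = det ?D * det ?S"
    by (rule det_four_block_mat_upper_right_zero[of _ n _ k]) (auto simp: dc)
  finally show ?thesis .
qed

text \<open>The two matrices are similar if the $b_i$ and $b'_i$ are all nonzero, but in general they are not:
with $a_i = 1$, $b_i = 0$, $a'_i = b'_i = 0$ the ranks may differ.  The characteristic polynomials
still agree, since they agree at all but finitely many points.\<close>

lemma char_poly_arrow_scaling:
  fixes U V W :: "real mat"
  assumes U: "U \<in> carrier_mat n k" and V: "V \<in> carrier_mat k n" and W: "W \<in> carrier_mat k k"
    and ab: "\<And>i. i < n \<Longrightarrow> a i * b i = a' i * b' i"
  shows "char_poly (four_block_mat (mat_diag n d) (mat_diag n a * U) (V * mat_diag n b) W) =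
    char_poly (four_block_mat (mat_diag n d) (mat_diag n a' * U) (V * mat_diag n b') W)"
proof (rule poly_eq_off_finite)
  fix z assume "z \<notin> d ` {..<n}"
  then have z: "\<And>i. i < n \<Longrightarrow> z \<noteq> d i" by auto
  have "mat_diag n (\<lambda>i. a i * b i / (z - d i)) = mat_diag n (\<lambda>i. a' i * b' i / (z - d i))"
    by (rule eq_matI) (auto simp: mat_diag_def ab)
  then show "poly (char_poly (four_block_mat (mat_diag n d) (mat_diag n a * U) (V * mat_diag n b) W)) z =
    poly (char_poly (four_block_mat (mat_diag n d) (mat_diag n a' * U) (V * mat_diag n b') W)) z"
    using char_poly_arrow_eval[OF U V W z] by simp
qed simp

lemma same_eigenvalues_char_polyI:
  assumes P: "P \<in> carrier_mat n n" and Q: "Q \<in> carrier_mat n n" and eq: "char_poly P = char_poly Q"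
  shows "same_eigenvalues P Q"
proof -
  have "char_poly (map_mat complex_of_real P) = char_poly (map_mat complex_of_real Q)"
    using of_real_hom.char_poly_hom[OF P] of_real_hom.char_poly_hom[OF Q] eq by metis
  then show ?thesis
    using eigenvalue_root_char_poly[of "map_mat complex_of_real P" n]
      eigenvalue_root_char_poly[of "map_mat complex_of_real Q" n] P Q
    by (simp add: same_eigenvalues_def Let_def)
qed

section \<open>Reduction of the preconditioned matrix\<close>

lemma cong_block3:
  "P11 = Q11 \<Longrightarrow> P12 = Q12 \<Longrightarrow> P13 = Q13 \<Longrightarrow> P21 = Q21 \<Longrightarrow> P22 = Q22 \<Longrightarrow> P23 = Q23 \<Longrightarrow>
   P31 = Q31 \<Longrightarrow> P32 = Q32 \<Longrightarrow> P33 = Q33 \<Longrightarrow>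
   block3 P11 P12 P13 P21 P22 P23 P31 P32 P33 = block3 Q11 Q12 Q13 Q21 Q22 Q23 Q31 Q32 Q33"
  by simp

lemmas block3_mult_eqI = trans[OF mult_block3 cong_block3]

lemma char_poly_block3_arrow_scaling:
  fixes U1 U2 V1 V2 W22 W23 W32 W33 :: "real mat"
  assumes U: "U1 \<in> carrier_mat n m" "U2 \<in> carrier_mat n l"
    and V: "V1 \<in> carrier_mat m n" "V2 \<in> carrier_mat l n"
    and W: "W22 \<in> carrier_mat m m" "W23 \<in> carrier_mat m l" "W32 \<in> carrier_mat l m" "W33 \<in> carrier_mat l l"
    and ab: "\<And>i. i < n \<Longrightarrow> a i * b i = a' i * b' i"
  shows "char_poly (block3 (mat_diag n d) (mat_diag n a * U1) (mat_diag n a * U2)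
       (V1 * mat_diag n b) W22 W23 (V2 * mat_diag n b) W32 W33) =
     char_poly (block3 (mat_diag n d) (mat_diag n a' * U1) (mat_diag n a' * U2)
       (V1 * mat_diag n b') W22 W23 (V2 * mat_diag n b') W32 W33)"
proof -
  have regroup: "block3 (mat_diag n d) (mat_diag n a * U1) (mat_diag n a * U2)
       (V1 * mat_diag n b) W22 W23 (V2 * mat_diag n b) W32 W33
     = four_block_mat (mat_diag n d) (mat_diag n a * beside U1 U2)
         ((V1 @\<^sub>r V2) * mat_diag n b) (four_block_mat W22 W23 W32 W33)" for a b
  proof -
    have c: "mat_diag n a * U1 \<in> carrier_mat n m" "mat_diag n a * U2 \<in> carrier_mat n l"
      "V1 * mat_diag n b \<in> carrier_mat m n" "V2 * mat_diag n b \<in> carrier_mat l n"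
      using U V mult_carrier_mat[OF mat_diag_dim] mult_carrier_mat[OF _ mat_diag_dim] by blast+
    show ?thesis
      unfolding block3_regroup[OF mat_diag_dim c(1,2) c(3) W(1,2) c(4) W(3,4)]
        mult_beside[OF U mat_diag_dim] append_rows_mult[OF V mat_diag_dim] ..
  qed
  show ?thesis unfolding regroup
    by (rule char_poly_arrow_scaling[of _ n "m + l"])
      (use U V W ab in \<open>auto intro!: beside_carrier\<close>)
qed

text \<open>Here $t$ stands for $A^{1/2}X$ and $q_1 = A^{-1/2}X$ for its inverse transpose, while $s$, $r$ and
$q_2$, $q_3$ are the square roots of the other two diagonal blocks and their inverses.  With the
factorisation $M = LEU$ and $Q = \mathrm{diag}(q_1, q_2, q_3)$, the matrix $V = U^{-1}Q$ is a
change of basis from $M^{-1}K$ to $K_1$.  Verifying $KV = MVK_1 = LEQK_1$ needs no inverse of $L$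
or $U$.\<close>

lemma char_poly_preconditioned:
  fixes A B C D MA S MS W Y Z N t q1 s q2 r q3 :: "real mat"
  assumes B: "B \<in> carrier_mat m n" and C: "C \<in> carrier_mat l m" and D: "D \<in> carrier_mat l l"
    and MA: "MA \<in> carrier_mat n n" "N \<in> carrier_mat n n" "MA * N = 1\<^sub>m n"
    and W: "W \<in> carrier_mat m m" "transpose_mat W = W"
    and Y: "Y \<in> carrier_mat n n" and Z: "Z \<in> carrier_mat n n"
    and t: "t \<in> carrier_mat n n" "q1 \<in> carrier_mat n n" "transpose_mat t * q1 = 1\<^sub>m n"
    and s: "s \<in> carrier_mat m m" "q2 \<in> carrier_mat m m" "transpose_mat q2 = q2" "s * q2 = 1\<^sub>m m"
    and r: "r \<in> carrier_mat l l" "q3 \<in> carrier_mat l l" "transpose_mat q3 = q3" "r * q3 = 1\<^sub>m l"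
    and A: "A = t * transpose_mat t" and S: "S = s * s" and MS: "MS = r * r"
    and \<Lambda>: "\<Lambda> = transpose_mat t * N * t" and \<Lambda>Y: "\<Lambda>Y = transpose_mat t * Y * t"
    and \<Lambda>Z: "\<Lambda>Z = transpose_mat t * Z * t" and \<Gamma>: "\<Gamma> = \<Lambda>Y + \<Lambda>Z - \<Lambda>Y * \<Lambda>Z"
    and G: "G = q2 * B * q1" and H: "H = q3 * C * q2" and J: "J = q3 * C * W * B * q1"
    and K: "K = block3 A (transpose_mat B) (0\<^sub>m n l)
                       B (0\<^sub>m m m) (transpose_mat C)
                       (0\<^sub>m l n) C D"
    and M: "M = block3 (1\<^sub>m n) (0\<^sub>m n m) (0\<^sub>m n l)
                       (B * Y) (1\<^sub>m m) (0\<^sub>m m l)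
                       (0\<^sub>m l n) (- (C * W)) (1\<^sub>m l)
              * block3 MA (0\<^sub>m n m) (0\<^sub>m n l)
                       (0\<^sub>m m n) (- S) (0\<^sub>m m l)
                       (0\<^sub>m l n) (0\<^sub>m l m) MS
              * block3 (1\<^sub>m n) (Z * transpose_mat B) (0\<^sub>m n l)
                       (0\<^sub>m m n) (1\<^sub>m m) (- (W * transpose_mat C))
                       (0\<^sub>m l n) (0\<^sub>m l m) (1\<^sub>m l)"
    and K1: "K1 = block3
       \<Lambda> (\<Lambda> * (1\<^sub>m n - \<Lambda>Z) * transpose_mat G) (\<Lambda> * (1\<^sub>m n - \<Lambda>Z) * transpose_mat J)
       (- G * (1\<^sub>m n - \<Lambda>Y)) (G * \<Gamma> * transpose_mat G) (G * \<Gamma> * transpose_mat J - transpose_mat H)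
       (J * (1\<^sub>m n - \<Lambda>Y)) (H - J * \<Gamma> * transpose_mat G)
         (q3 * D * q3 + (2 \<cdot>\<^sub>m (q3 * C * W * transpose_mat C * q3) - J * \<Gamma> * transpose_mat J))"
  shows "M \<in> carrier_mat (n + m + l) (n + m + l)" "det M \<noteq> 0"
    "char_poly (mat_inv M * K) = char_poly K1"
proof -
  let ?k = "n + m + l"
  have [simp]: "dim_row B = m" "dim_col B = n" "dim_row C = l" "dim_col C = m" "dim_row D = l" "dim_col D = l"
    "dim_row MA = n" "dim_col MA = n" "dim_row N = n" "dim_col N = n" "dim_row W = m" "dim_col W = m"
    "dim_row Y = n" "dim_col Y = n" "dim_row Z = n" "dim_col Z = n" "dim_row t = n" "dim_col t = n"
    "dim_row q1 = n" "dim_col q1 = n" "dim_row s = m" "dim_col s = m" "dim_row q2 = m" "dim_col q2 = m"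
    "dim_row r = l" "dim_col r = l" "dim_row q3 = l" "dim_col q3 = l"
    using B C D MA W Y Z t s r by auto
  have tq: "q1 * transpose_mat t = 1\<^sub>m n"
    using mat_mult_left_right_inverse[OF _ t(2,3)] t(1) by simp
  have tq': "transpose_mat q1 * t = 1\<^sub>m n" "t * transpose_mat q1 = 1\<^sub>m n"
    using arg_cong[OF t(3), of transpose_mat] arg_cong[OF tq, of transpose_mat]
    by (simp_all add: transpose_mult_dim)
  have NMA: "N * MA = 1\<^sub>m n" using mat_mult_left_right_inverse[OF MA] .
  note inv = t(3) tq tq' MA(3) NMA s(4) r(4)
  note canc = inv inv[THEN left_cancel_dim]
  note ring = mat_expand canc W(2) s(3) r(3)
  have dc: "P \<in> carrier_mat x y \<longleftrightarrow> dim_row P = x \<and> dim_col P = y" for P :: "real mat" and x y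
    unfolding carrier_mat_def mem_Collect_eq ..
  have [simp]: "dim_row A = n" "dim_col A = n" "dim_row S = m" "dim_col S = m" "dim_row MS = l" "dim_col MS = l"
    "dim_row \<Lambda> = n" "dim_col \<Lambda> = n" "dim_row \<Lambda>Y = n" "dim_col \<Lambda>Y = n" "dim_row \<Lambda>Z = n" "dim_col \<Lambda>Z = n"
    "dim_row \<Gamma> = n" "dim_col \<Gamma> = n" "dim_row G = m" "dim_col G = n" "dim_row H = l" "dim_col H = m"
    "dim_row J = l" "dim_col J = n"
    by (simp_all add: A S MS \<Lambda> \<Lambda>Y \<Lambda>Z \<Gamma> G H J)
  define L where "L = block3 (1\<^sub>m n) (0\<^sub>m n m) (0\<^sub>m n l) (B * Y) (1\<^sub>m m) (0\<^sub>m m l) (0\<^sub>m l n) (- (C * W)) (1\<^sub>m l)"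
  define E where "E = block3 MA (0\<^sub>m n m) (0\<^sub>m n l) (0\<^sub>m m n) (- S) (0\<^sub>m m l) (0\<^sub>m l n) (0\<^sub>m l m) MS"
  define U where "U = block3 (1\<^sub>m n) (Z * transpose_mat B) (0\<^sub>m n l)
                       (0\<^sub>m m n) (1\<^sub>m m) (- (W * transpose_mat C)) (0\<^sub>m l n) (0\<^sub>m l m) (1\<^sub>m l)"
  define Q where "Q = block3 q1 (0\<^sub>m n m) (0\<^sub>m n l) (0\<^sub>m m n) q2 (0\<^sub>m m l) (0\<^sub>m l n) (0\<^sub>m l m) q3"
  \<comment> \<open>this is \<open>U\<^sup>-\<^sup>1 Q\<close>, written out by back substitution\<close>
  define V where "V = block3 q1 (- (Z * transpose_mat B * q2)) (- (Z * transpose_mat B * W * transpose_mat C * q3))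
                       (0\<^sub>m m n) q2 (W * transpose_mat C * q3) (0\<^sub>m l n) (0\<^sub>m l m) q3"
  have M': "M = L * E * U" unfolding M L_def E_def U_def ..
  have carr: "L \<in> carrier_mat ?k ?k" "E \<in> carrier_mat ?k ?k" "U \<in> carrier_mat ?k ?k"
    "Q \<in> carrier_mat ?k ?k" "V \<in> carrier_mat ?k ?k" "K \<in> carrier_mat ?k ?k" "K1 \<in> carrier_mat ?k ?k"
    unfolding L_def E_def U_def Q_def V_def K K1 by (rule block3_carrier; simp add: dc)+
  then have [simp]: "dim_row L = ?k" "dim_row E = ?k" "dim_row U = ?k" "dim_row Q = ?k" "dim_row V = ?k"
    "dim_row K = ?k" "dim_row K1 = ?k" "dim_col L = ?k" "dim_col E = ?k" "dim_col U = ?k" "dim_col Q = ?k"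
    "dim_col V = ?k" "dim_col K = ?k" "dim_col K1 = ?k" by auto
  show Mc: "M \<in> carrier_mat ?k ?k" unfolding M' by (simp add: dc)
  then have [simp]: "dim_row M = ?k" "dim_col M = ?k" by auto
  have dets: "det MA \<noteq> 0" "det q1 \<noteq> 0" "det s \<noteq> 0" "det q2 \<noteq> 0" "det r \<noteq> 0" "det q3 \<noteq> 0"
    using det_mult[OF MA(1,2)] det_mult[OF t(2), of "transpose_mat t"] det_mult[OF s(1,2)] det_mult[OF r(1,2)]
      MA(3) tq s(4) r(4) t(1) by auto
  have "det E \<noteq> 0"
  proof -
    have "det S \<noteq> 0" "det MS \<noteq> 0" unfolding S MS
      using dets det_mult[OF s(1,1)] det_mult[OF r(1,1)] by auto
    moreover have "det (- S) \<noteq> 0"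
      using \<open>det S \<noteq> 0\<close> det_0_negate[of S m] by (simp add: dc)
    moreover have "det E = det MA * det (- S) * det MS"
      unfolding E_def by (rule det_block3_lower) (simp_all add: dc)
    ultimately show ?thesis using dets by simp
  qed
  moreover have "det L = det (1\<^sub>m n :: real mat) * det (1\<^sub>m m :: real mat) * det (1\<^sub>m l :: real mat)"
    unfolding L_def by (rule det_block3_lower) (simp_all add: dc)
  moreover have "det U = det (1\<^sub>m n :: real mat) * det (1\<^sub>m m :: real mat) * det (1\<^sub>m l :: real mat)"
    unfolding U_def by (rule det_block3_upper) (simp_all add: dc)
  moreover have "det M = det L * det E * det U"
    unfolding M' using carr by (simp add: det_mult[of _ ?k] mult_carrier_mat[of _ ?k ?k])
  ultimately show detM: "det M \<noteq> 0" by simp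
  have "det V = det q1 * det q2 * det q3"
    unfolding V_def by (rule det_block3_upper) (simp_all add: dc)
  then have detV: "det V \<noteq> 0" using dets by simp
  have UV: "U * V = Q"
    unfolding U_def V_def Q_def
    by (rule block3_mult_eqI) ((simp add: dc; fail) | (rule eq_matI; simp add: ring del: index_mult_mat(1)))+
  define E' where "E' = block3 (MA * q1) (0\<^sub>m n m) (0\<^sub>m n l) (0\<^sub>m m n) (- s) (0\<^sub>m m l) (0\<^sub>m l n) (0\<^sub>m l m) r"
  have EQ: "E * Q = E'"
    unfolding E_def Q_def E'_def S MS
    by (rule block3_mult_eqI) ((simp add: dc; fail) | (rule eq_matI; simp add: ring del: index_mult_mat(1)))+
  define F where "F = block3 t (transpose_mat B * q2 - t * \<Lambda>Z * transpose_mat G) 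
      ((transpose_mat B - t * \<Lambda>Z * transpose_mat q1 * transpose_mat B) * W * transpose_mat C * q3)
     (B * q1 * (1\<^sub>m n - \<Lambda>Y)) (- (s * G * \<Gamma> * transpose_mat G)) (- (s * (G * \<Gamma> * transpose_mat J - transpose_mat H)))
     (r * J * (1\<^sub>m n - \<Lambda>Y)) (r * (H - J * \<Gamma> * transpose_mat G)) 
     (r * (q3 * D * q3 + (2 \<cdot>\<^sub>m (q3 * C * W * transpose_mat C * q3) - J * \<Gamma> * transpose_mat J)))"
  have EK1: "E' * K1 = F"
    unfolding E'_def K1 F_def \<Lambda> \<Lambda>Y \<Lambda>Z \<Gamma> G H J
    by (rule block3_mult_eqI) ((simp add: dc; fail) | (rule eq_matI; simp add: ring del: index_mult_mat(1)))+
  have LF: "L * F = K * V"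
  proof -
    \<comment> \<open>the common normal form of both products in terms of the original blocks\<close>
    define X where "X = block3 t (transpose_mat B * q2 - t * (transpose_mat t * Z * transpose_mat B * q2)) 
      (transpose_mat B * W * transpose_mat C * q3 - t * (transpose_mat t * Z * transpose_mat B * W * transpose_mat C * q3))
      (B * q1) (- (B * Z * transpose_mat B * q2)) (transpose_mat C * q3 - B * Z * transpose_mat B * W * transpose_mat C * q3)
      (0\<^sub>m l n) (C * q2) (C * W * transpose_mat C * q3 + D * q3)"
    have "L * F = X"
      unfolding L_def F_def X_def \<Lambda> \<Lambda>Y \<Lambda>Z \<Gamma> G H J
      by (rule block3_mult_eqI) ((simp add: dc; fail) | (rule eq_matI; simp add: ring del: index_mult_mat(1)))+
    moreover have "K * V = X"
      unfolding K V_def X_def A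
      by (rule block3_mult_eqI) ((simp add: dc; fail) | (rule eq_matI; simp add: ring del: index_mult_mat(1)))+
    ultimately show ?thesis by simp
  qed
  have KV: "K * V = M * (V * K1)"
  proof -
    have "M * (V * K1) = L * (E * ((U * V) * K1))" unfolding M' by (simp add: mult_assoc_dim)
    also have "\<dots> = L * ((E * Q) * K1)" unfolding UV by (simp add: mult_assoc_dim)
    also have "\<dots> = K * V" unfolding EQ EK1 LF ..
    finally show ?thesis by simp
  qed
  note Mi = mat_inv[OF Mc detM] and Vi = mat_inv[OF carr(5) detV]
  have [simp]: "dim_row (mat_inv M) = ?k" "dim_col (mat_inv M) = ?k" "dim_row (mat_inv V) = ?k" "dim_col (mat_inv V) = ?k"
    using Mi Vi by auto
  have "mat_inv M * K = mat_inv M * (K * V) * mat_inv V"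
    by (simp add: mult_assoc_dim Vi mult_one_dim)
  also have "\<dots> = V * K1 * mat_inv V"
    unfolding KV by (simp add: left_cancel_dim[OF Mi(3)])
  finally have "similar_mat (mat_inv M * K) K1"
    by (intro similar_matI[of _ _ V "mat_inv V" ?k]) (auto simp: dc Vi)
  then show "char_poly (mat_inv M * K) = char_poly K1" by (rule char_poly_similar)
qed

section \<open>The eigenvalues of the preconditioned matrix\<close>

lemma diagonal_mat_eq_mat_diag:
  assumes "A \<in> carrier_mat n n" "diagonal_mat A"
  shows "A = mat_diag n (\<lambda>i. A $$ (i,i))"
  using assms by (intro eq_matI) (auto simp: diagonal_mat_def mat_diag_def)

lemma diagonal_mat_mat_diag: "diagonal_mat (mat_diag n f)"
  by (auto simp: diagonal_mat_def mat_diag_def)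

lemma mat_diag_add: "mat_diag n f + mat_diag n g = mat_diag n (\<lambda>i. f i + g i :: real)"
  and mat_diag_minus: "mat_diag n f - mat_diag n g = mat_diag n (\<lambda>i. f i - g i :: real)"
  and mat_diag_smult: "c \<cdot>\<^sub>m mat_diag n f = mat_diag n (\<lambda>i. c * f i :: real)"
  and mat_diag_zero: "mat_diag n (\<lambda>i. 0) = (0\<^sub>m n n :: real mat)"
  by (rule eq_matI; auto simp: mat_diag_def)+

lemma mat_diag_cong: "(\<And>i. i < n \<Longrightarrow> f i = g i) \<Longrightarrow> mat_diag n f = mat_diag n g"
  by (rule eq_matI) (auto simp: mat_diag_def)

lemma mat_diag_index: "i < n \<Longrightarrow> mat_diag n f $$ (i,i) = f i"
  by (simp add: mat_diag_def)

theorem theorem2p1: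
  fixes n m l :: nat
    and A B C D K MA S MS WS YA ZA M X :: "real mat"
    and \<Lambda> \<Lambda>Y \<Lambda>Z \<Gamma> G H Dhat GW HW FW \<Delta>p \<Delta>m KP :: "real mat"
  assumes A: "spd n A"
    and B: "B \<in> carrier_mat m n" "m \<le> n" "full_row_rank B"
    and D: "sym_psd l D"
    and C: "C \<in> carrier_mat l m" "\<not> spd l D \<longrightarrow> full_row_rank C"
    and K: "K = block3 A             (transpose_mat B) (0\<^sub>m n l)
                       B             (0\<^sub>m m m)         (transpose_mat C)
                       (0\<^sub>m l n)     C                 D"
    and MA: "spd n MA"
    and S: "spd m S"
    and MS: "spd l MS"
    and WS: "WS \<in> {0\<^sub>m m m, mat_inv S}"
    and YA: "YA \<in> {0\<^sub>m n n, mat_inv MA}"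
    and ZA: "ZA \<in> {0\<^sub>m n n, mat_inv MA}"
    and M: "M = block3 (1\<^sub>m n)    (0\<^sub>m n m)   (0\<^sub>m n l)
                       (B * YA)   (1\<^sub>m m)     (0\<^sub>m m l)
                       (0\<^sub>m l n)  (- (C * WS)) (1\<^sub>m l)
              * block3 MA         (0\<^sub>m n m)   (0\<^sub>m n l)
                       (0\<^sub>m m n)  (- S)        (0\<^sub>m m l)
                       (0\<^sub>m l n)  (0\<^sub>m l m)   MS
              * block3 (1\<^sub>m n)    (ZA * transpose_mat B) (0\<^sub>m n l)
                       (0\<^sub>m m n)  (1\<^sub>m m)               (- (WS * transpose_mat C))
                       (0\<^sub>m l n)  (0\<^sub>m l m)             (1\<^sub>m l)"
    and X: "orthogonal_matrix n X"
    and \<Lambda>: "\<Lambda> = transpose_mat X * mat_sqrt A * mat_inv MA * mat_sqrt A * X"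
    and \<Lambda>_diagonal: "diagonal_mat \<Lambda>"
    and \<Lambda>Y: "\<Lambda>Y = transpose_mat X * mat_sqrt A * YA * mat_sqrt A * X"
    and \<Lambda>Z: "\<Lambda>Z = transpose_mat X * mat_sqrt A * ZA * mat_sqrt A * X"
    and \<Gamma>: "\<Gamma> = \<Lambda>Y + \<Lambda>Z - \<Lambda>Y * \<Lambda>Z"
    and G: "G = mat_inv_sqrt S * B * mat_inv_sqrt A * X"
    and H: "H = mat_inv_sqrt MS * C * mat_inv_sqrt S"
    and Dhat: "Dhat = mat_inv_sqrt MS * D * mat_inv_sqrt MS"
    and GW: "GW = mat_sqrt WS * B * mat_inv_sqrt A * X"
    and HW: "HW = mat_inv_sqrt MS * C * mat_sqrt WS"
    and FW: "FW = 2 \<cdot>\<^sub>m 1\<^sub>m m - GW * \<Gamma> * transpose_mat GW"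
    and \<Delta>p: "\<Delta>p = mat_diag n (\<lambda>i. sqrt (max ((1\<^sub>m n - \<Gamma>) $$ (i, i)) 0))"
    and \<Delta>m: "\<Delta>m = mat_diag n (\<lambda>i. sqrt (max ((\<Gamma> - 1\<^sub>m n) $$ (i, i)) 0))"
    and KP: "KP = block3
       \<Lambda>
         ((\<Delta>p + \<Delta>m) * mat_sqrt \<Lambda> * transpose_mat G)
         ((\<Delta>p + \<Delta>m) * mat_sqrt \<Lambda> * transpose_mat GW * transpose_mat HW)
       (- (G * mat_sqrt \<Lambda> * (\<Delta>p - \<Delta>m)))
         (G * \<Gamma> * transpose_mat G)
         (G * \<Gamma> * transpose_mat GW * transpose_mat HW - transpose_mat H)
       (HW * GW * mat_sqrt \<Lambda> * (\<Delta>p - \<Delta>m))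
         (H - HW * GW * \<Gamma> * transpose_mat G)
         (Dhat + HW * FW * transpose_mat HW)"
  shows
    "(diagonal_mat \<Lambda>Y \<and> diagonal_mat \<Lambda>Z \<and> diagonal_mat \<Gamma> \<and>
      (YA + ZA = 0\<^sub>m n n \<longrightarrow> \<Gamma> = 0\<^sub>m n n) \<and>
      (YA + ZA = mat_inv MA \<longrightarrow> \<Gamma> = \<Lambda>) \<and>
      (YA + ZA = 2 \<cdot>\<^sub>m mat_inv MA \<longrightarrow> \<Gamma> = 2 \<cdot>\<^sub>m \<Lambda> - \<Lambda> * \<Lambda>) \<and>
      1\<^sub>m n - \<Gamma> = (1\<^sub>m n - \<Lambda>Y) * (1\<^sub>m n - \<Lambda>Z) \<and>
      (1\<^sub>m n - \<Lambda>Y) * (1\<^sub>m n - \<Lambda>Z) = \<Delta>p * \<Delta>p - \<Delta>m * \<Delta>m)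
     \<and> (invertible_mat M \<and> same_eigenvalues (mat_inv M * K) KP)"
proof -
  define N where "N = mat_inv MA"
  have MAc: "MA \<in> carrier_mat n n" using MA by (simp add: spd_def)
  note N = mat_inv[OF MAc spd_det[OF MA], folded N_def]
  note rA = spd_mat_sqrt[OF A] and rS = spd_mat_sqrt[OF S] and rMS = spd_mat_sqrt[OF MS]
  have Xc: "X \<in> carrier_mat n n" and XX: "transpose_mat X * X = 1\<^sub>m n" "X * transpose_mat X = 1\<^sub>m n"
    using X by (auto simp: orthogonal_matrix_def)
  have Ac: "A \<in> carrier_mat n n" and Dc: "D \<in> carrier_mat l l"
    using A D by (auto simp: spd_def sym_psd_def)
  have YAc: "YA \<in> carrier_mat n n" and ZAc: "ZA \<in> carrier_mat n n"
    using YA ZA N by (auto simp: N_def)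
  have "sym_psd m (0\<^sub>m m m)"
    using sym_psd_mat_diag[of m "\<lambda>i. 0"] by (simp add: mat_diag_zero)
  then have WSp: "sym_psd m WS"
    using WS sym_psd_mat_inv[OF spd_imp_sym_psd[OF S] spd_det[OF S]] by auto
  \<comment> \<open>both choices of \<open>WS\<close> are treated at once: only a symmetric \<open>w\<close> with \<open>w * w = WS\<close> matters\<close>
  define w where "w = mat_sqrt WS"
  have w: "w \<in> carrier_mat m m" "transpose_mat w = w" "w * w = WS"
    using mat_sqrt[OF WSp] by (auto simp: w_def sym_psd_def)
  have WSc: "WS \<in> carrier_mat m m" and WSt: "transpose_mat WS = WS"
    using WSp by (auto simp: sym_psd_def)
  define t where "t = mat_sqrt A * X"
  define q1 where "q1 = mat_inv_sqrt A * X"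
  have [simp]: "dim_row (mat_sqrt A) = n" "dim_col (mat_sqrt A) = n" "dim_row (mat_inv_sqrt A) = n"
    "dim_col (mat_inv_sqrt A) = n" "dim_row X = n" "dim_col X = n" "dim_row N = n" "dim_col N = n"
    "dim_row (mat_inv_sqrt S) = m" "dim_col (mat_inv_sqrt S) = m"
    "dim_row (mat_inv_sqrt MS) = l" "dim_col (mat_inv_sqrt MS) = l"
    "dim_row YA = n" "dim_col YA = n" "dim_row ZA = n" "dim_col ZA = n" "dim_row w = m" "dim_col w = m"
    "dim_row B = m" "dim_col B = n" "dim_row C = l" "dim_col C = m" "dim_row D = l" "dim_col D = l"
    "dim_row WS = m" "dim_col WS = m"
    using carrier_matD[OF rA(1)] carrier_matD[OF rA(4)] carrier_matD[OF Xc] carrier_matD[OF N(1)]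
      carrier_matD[OF rS(4)] carrier_matD[OF rMS(4)] carrier_matD[OF YAc] carrier_matD[OF ZAc]
      carrier_matD[OF w(1)] carrier_matD[OF B(1)] carrier_matD[OF C(1)] carrier_matD[OF Dc] carrier_matD[OF WSc]
    by - assumption+
  have [simp]: "dim_row t = n" "dim_col t = n" "dim_row q1 = n" "dim_col q1 = n"
    by (auto simp: t_def q1_def)
  have [simp]: "dim_row (mat_diag n f) = n" "dim_col (mat_diag n f) = n" for f :: "nat \<Rightarrow> real"
    by (auto simp: mat_diag_def)
  note canc = XX XX[THEN left_cancel_dim] rA(6,7) rA(6,7)[THEN left_cancel_dim]
  have tt: "A = t * transpose_mat t"
    unfolding t_def by (simp add: mat_expand canc rA(2,3))
  have tq: "transpose_mat t * q1 = 1\<^sub>m n"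
    unfolding t_def q1_def by (simp add: mat_expand canc rA(2))
  have \<Lambda>t: "\<Lambda> = transpose_mat t * N * t" and \<Lambda>Yt: "\<Lambda>Y = transpose_mat t * YA * t"
    and \<Lambda>Zt: "\<Lambda>Z = transpose_mat t * ZA * t"
    unfolding \<Lambda> \<Lambda>Y \<Lambda>Z t_def N_def[symmetric] by (simp_all add: mat_expand rA(2))
  define d where "d i = \<Lambda> $$ (i,i)" for i
  have \<Lambda>d: "\<Lambda> = mat_diag n d"
    unfolding d_def by (rule diagonal_mat_eq_mat_diag[OF _ \<Lambda>_diagonal]) (auto simp: \<Lambda>t intro!: carrier_matI)
  have "sym_psd n \<Lambda>"
    unfolding \<Lambda>t N_def
    by (intro sym_psd_congruence[OF sym_psd_mat_inv[OF spd_imp_sym_psd[OF MA] spd_det[OF MA]]])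
      (auto intro!: carrier_matI)
  from sym_psd_diag_nonneg[OF this] have d0: "0 \<le> d i" if "i < n" for i
    using that by (simp add: d_def)
  define y where "y i = (if YA = 0\<^sub>m n n then 0 else d i)" for i
  define z where "z i = (if ZA = 0\<^sub>m n n then 0 else d i)" for i
  have yd: "\<Lambda>Y = mat_diag n y"
  proof (cases "YA = 0\<^sub>m n n")
    case True
    then show ?thesis unfolding y_def \<Lambda>Yt by (simp add: mat_expand mat_diag_zero)
  next
    case False
    then have "YA = N" using YA by (simp add: N_def)
    with False show ?thesis unfolding y_def \<Lambda>Yt by (simp add: \<Lambda>d[symmetric] \<Lambda>t)
  qed
  have zd: "\<Lambda>Z = mat_diag n z"
  proof (cases "ZA = 0\<^sub>m n n")
    case True
    then show ?thesis unfolding z_def \<Lambda>Zt by (simp add: mat_expand mat_diag_zero)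
  next
    case False
    then have "ZA = N" using ZA by (simp add: N_def)
    with False show ?thesis unfolding z_def \<Lambda>Zt by (simp add: \<Lambda>d[symmetric] \<Lambda>t)
  qed
  define g where "g i = y i + z i - y i * z i" for i
  have \<Gamma>d: "\<Gamma> = mat_diag n g"
    unfolding \<Gamma> yd zd g_def by (simp add: mat_diag_add mat_diag_minus)
  have one: "1\<^sub>m n = mat_diag n (\<lambda>i. 1 :: real)" by simp
  have sum: "\<Lambda>Y + \<Lambda>Z = transpose_mat t * (YA + ZA) * t"
    unfolding \<Lambda>Yt \<Lambda>Zt by (simp add: mat_expand)
  have yz: "y i + z i = c * d i" if "YA + ZA = c \<cdot>\<^sub>m N" "i < n" for c i
  proof -
    have "\<Lambda>Y + \<Lambda>Z = c \<cdot>\<^sub>m \<Lambda>" unfolding sum that \<Lambda>t by (simp add: mat_expand)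
    from arg_cong[OF this, of "\<lambda>M. M $$ (i,i)"] show ?thesis
      using that(2) unfolding yd zd \<Lambda>d by (simp add: mat_diag_index)
  qed
  have yz': "y i = 0 \<or> y i = d i" "z i = 0 \<or> z i = d i" for i by (auto simp: y_def z_def)
  \<comment> \<open>Comparing diagonals of \<open>\<Lambda>Y + \<Lambda>Z\<close> covers every choice of \<open>YA\<close> and \<open>ZA\<close> at once; a choice
    that does not fit the given sum forces \<open>d i = 0\<close>, and the claim then holds trivially.\<close>
  have i0: "\<Gamma> = 0\<^sub>m n n" if h: "YA + ZA = 0\<^sub>m n n"
  proof -
    have "YA + ZA = 0 \<cdot>\<^sub>m N" unfolding h by (rule eq_matI) auto
    from yz[OF this] show ?thesis
      unfolding \<Gamma>d mat_diag_zero[symmetric] g_def using yz' by (intro mat_diag_cong) force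
  qed
  have i1: "\<Gamma> = \<Lambda>" if h: "YA + ZA = N"
  proof -
    have "YA + ZA = 1 \<cdot>\<^sub>m N" unfolding h by (rule eq_matI) auto
    from yz[OF this] show ?thesis
      unfolding \<Gamma>d \<Lambda>d g_def using yz' by (intro mat_diag_cong) force
  qed
  have i2: "\<Gamma> = 2 \<cdot>\<^sub>m \<Lambda> - \<Lambda> * \<Lambda>" if h: "YA + ZA = 2 \<cdot>\<^sub>m N"
    unfolding \<Gamma>d \<Lambda>d g_def mat_diag_smult mat_diag_diag mat_diag_minus
  proof (rule mat_diag_cong)
    fix i assume "i < n"
    then show "y i + z i - y i * z i = 2 * d i - d i * d i"
      using yz[OF h] yz'[of i] by force
  qed
  define p where "p i = sqrt (max (1 - g i) 0)" for i
  define q where "q i = sqrt (max (g i - 1) 0)" for i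
  have pd: "\<Delta>p = mat_diag n p"
    unfolding \<Delta>p \<Gamma>d p_def one mat_diag_minus by (rule mat_diag_cong) (simp add: mat_diag_index)
  have qd: "\<Delta>m = mat_diag n q"
    unfolding \<Delta>m \<Gamma>d q_def one mat_diag_minus by (rule mat_diag_cong) (simp add: mat_diag_index)
  have pq: "p i * p i - q i * q i = 1 - g i" for i
    by (auto simp: p_def q_def max_def)
  have g1: "1 - g i = (1 - y i) * (1 - z i)" for i by (simp add: g_def algebra_simps)
  have i3: "1\<^sub>m n - \<Gamma> = (1\<^sub>m n - \<Lambda>Y) * (1\<^sub>m n - \<Lambda>Z)"
    unfolding \<Gamma>d yd zd one mat_diag_minus mat_diag_diag g1 ..
  have i4: "(1\<^sub>m n - \<Lambda>Y) * (1\<^sub>m n - \<Lambda>Z) = \<Delta>p * \<Delta>p - \<Delta>m * \<Delta>m"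
    unfolding yd zd pd qd one mat_diag_minus mat_diag_diag pq g1 ..
  \<comment> \<open>\<open>J\<close> is \<open>HW * GW\<close>, in which the two square roots of \<open>WS\<close> merge\<close>
  define J where "J = mat_inv_sqrt MS * C * WS * B * q1"
  have Gq: "G = mat_inv_sqrt S * B * q1" unfolding G q1_def by (simp add: mat_expand)
  have [simp]: "dim_row G = m" "dim_col G = n" "dim_row J = l" "dim_col J = n"
    "dim_row \<Gamma> = n" "dim_col \<Gamma> = n" "dim_row H = l" "dim_col H = m"
    by (auto simp: Gq J_def \<Gamma>d H)
  have HGJ: "HW * GW = J"
    unfolding HW GW w_def[symmetric] unfolding J_def q1_def w(3)[symmetric] by (simp add: mat_expand)
  have [simp]: "dim_row GW = m" "dim_col GW = n" "dim_row HW = l" "dim_col HW = m"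
    by (auto simp: GW HW w_def[symmetric])
  have GHJ: "transpose_mat GW * transpose_mat HW = transpose_mat J"
    unfolding HGJ[symmetric] by (simp add: mat_expand)
  have HWW: "HW * transpose_mat HW = mat_inv_sqrt MS * C * WS * transpose_mat C * mat_inv_sqrt MS"
    unfolding HW w_def[symmetric] unfolding w(3)[symmetric] by (simp add: mat_expand w(2) rMS(5))
  have HFH: "HW * FW * transpose_mat HW
      = 2 \<cdot>\<^sub>m (mat_inv_sqrt MS * C * WS * transpose_mat C * mat_inv_sqrt MS) - J * \<Gamma> * transpose_mat J"
    unfolding FW HWW[symmetric] HGJ[symmetric] by (simp add: mat_expand)
  define W33 where "W33 = mat_inv_sqrt MS * D * mat_inv_sqrt MS +
    (2 \<cdot>\<^sub>m (mat_inv_sqrt MS * C * WS * transpose_mat C * mat_inv_sqrt MS) - J * \<Gamma> * transpose_mat J)"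
  define K1 where "K1 = block3
       \<Lambda> (\<Lambda> * (1\<^sub>m n - \<Lambda>Z) * transpose_mat G) (\<Lambda> * (1\<^sub>m n - \<Lambda>Z) * transpose_mat J)
       (- G * (1\<^sub>m n - \<Lambda>Y)) (G * \<Gamma> * transpose_mat G) (G * \<Gamma> * transpose_mat J - transpose_mat H)
       (J * (1\<^sub>m n - \<Lambda>Y)) (H - J * \<Gamma> * transpose_mat G) W33"
  have tc: "t \<in> carrier_mat n n" "q1 \<in> carrier_mat n n" by (simp_all add: carrier_matI)
  note pc = char_poly_preconditioned[OF B(1) C(1) Dc MAc N(1,2) WSc WSt YAc ZAc tc tq rS(1,4,5,6) rMS(1,4,5,6) tt
        rS(3)[symmetric] rMS(3)[symmetric] \<Lambda>t \<Lambda>Yt \<Lambda>Zt \<Gamma> Gq H J_def K M K1_def[unfolded W33_def]]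
  have sq: "mat_sqrt \<Lambda> = mat_diag n (\<lambda>i. sqrt (d i))"
  proof (rule mat_sqrt_eqI)
    show "sym_psd n (mat_diag n (\<lambda>i. sqrt (d i)))" by (rule sym_psd_mat_diag) (simp add: d0)
    show "mat_diag n (\<lambda>i. sqrt (d i)) * mat_diag n (\<lambda>i. sqrt (d i)) = \<Lambda>"
      unfolding mat_diag_diag \<Lambda>d by (rule mat_diag_cong) (simp add: d0)
  qed
  \<comment> \<open>\<open>K1\<close> and \<open>KP\<close> differ only in how \<open>\<Lambda> * (1\<^sub>m n - \<Gamma>)\<close> is split between the first block row
    and the first block column\<close>
  define a where "a i = d i * (1 - z i)" for i
  define b where "b i = 1 - y i" for i
  define a' where "a' i = (p i + q i) * sqrt (d i)" for i
  define b' where "b' i = sqrt (d i) * (p i - q i)" for i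
  have K1d: "K1 = block3 (mat_diag n d) (mat_diag n a * transpose_mat G) (mat_diag n a * transpose_mat J)
     (- G * mat_diag n b) (G * \<Gamma> * transpose_mat G) (G * \<Gamma> * transpose_mat J - transpose_mat H)
     (J * mat_diag n b) (H - J * \<Gamma> * transpose_mat G) W33"
    unfolding K1_def \<Lambda>d yd zd one mat_diag_minus mat_diag_diag a_def b_def ..
  have ad: "(\<Delta>p + \<Delta>m) * mat_sqrt \<Lambda> = mat_diag n a'"
    unfolding pd qd sq mat_diag_add mat_diag_diag a'_def ..
  have bd: "mat_sqrt \<Lambda> * (\<Delta>p - \<Delta>m) = mat_diag n b'"
    unfolding pd qd sq mat_diag_minus mat_diag_diag b'_def ..
  have [simp]: "dim_row (mat_sqrt \<Lambda>) = n" "dim_col (mat_sqrt \<Lambda>) = n" "dim_row \<Delta>p = n" "dim_col \<Delta>p = n"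
    "dim_row \<Delta>m = n" "dim_col \<Delta>m = n" by (simp_all add: sq pd qd)
  have KPd: "KP = block3 (mat_diag n d) (mat_diag n a' * transpose_mat G) (mat_diag n a' * transpose_mat J)
     (- G * mat_diag n b') (G * \<Gamma> * transpose_mat G) (G * \<Gamma> * transpose_mat J - transpose_mat H)
     (J * mat_diag n b') (H - J * \<Gamma> * transpose_mat G) W33"
    unfolding KP
  proof (rule cong_block3)
    show "(\<Delta>p + \<Delta>m) * mat_sqrt \<Lambda> * transpose_mat GW * transpose_mat HW = mat_diag n a' * transpose_mat J"
      unfolding ad GHJ[symmetric] by (simp add: mult_assoc_dim)
    show "- (G * mat_sqrt \<Lambda> * (\<Delta>p - \<Delta>m)) = - G * mat_diag n b'"
      unfolding bd[symmetric] by (simp add: mult_assoc_dim uminus_mult_dim)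
    show "G * \<Gamma> * transpose_mat GW * transpose_mat HW - transpose_mat H = G * \<Gamma> * transpose_mat J - transpose_mat H"
      unfolding GHJ[symmetric] by (simp add: mult_assoc_dim)
    show "HW * GW * mat_sqrt \<Lambda> * (\<Delta>p - \<Delta>m) = J * mat_diag n b'"
      unfolding HGJ bd[symmetric] by (simp add: mult_assoc_dim)
    show "H - HW * GW * \<Gamma> * transpose_mat G = H - J * \<Gamma> * transpose_mat G" unfolding HGJ ..
    show "Dhat + HW * FW * transpose_mat HW = W33" unfolding W33_def HFH Dhat ..
    show "(\<Delta>p + \<Delta>m) * mat_sqrt \<Lambda> * transpose_mat G = mat_diag n a' * transpose_mat G" unfolding ad ..
  qed (simp_all add: \<Lambda>d)
  have "a i * b i = a' i * b' i" if "i < n" for i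
  proof -
    have "a' i * b' i = (sqrt (d i) * sqrt (d i)) * (p i * p i - q i * q i)"
      by (simp add: a'_def b'_def algebra_simps)
    also have "\<dots> = d i * (1 - g i)" unfolding pq using d0[OF that] by simp
    also have "\<dots> = a i * b i" unfolding g1 a_def b_def by simp
    finally show ?thesis ..
  qed
  then have "char_poly K1 = char_poly KP"
    unfolding K1d KPd
    by (intro char_poly_block3_arrow_scaling[of _ n m _ l]) (auto simp: W33_def intro!: carrier_matI)
  with pc(3) have "char_poly (mat_inv M * K) = char_poly KP" by simp
  moreover have "K \<in> carrier_mat (n + m + l) (n + m + l)"
    unfolding K by (rule block3_carrier[OF Ac _ Dc]) simp
  moreover have "KP \<in> carrier_mat (n + m + l) (n + m + l)"
    unfolding KPd by (rule block3_carrier; rule carrier_matI; simp add: W33_def)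
  moreover note Mi = mat_inv[OF pc(1,2)]
  ultimately have "same_eigenvalues (mat_inv M * K) KP"
    by (intro same_eigenvalues_char_polyI[of _ "n + m + l"]) auto
  moreover have "invertible_mat M"
    using pc(1) Mi unfolding invertible_mat_def inverts_mat_def by (auto intro!: exI[of _ "mat_inv M"])
  ultimately show ?thesis
    using i0 i1 i2 i3 i4 by (simp add: yd zd \<Gamma>d diagonal_mat_mat_diag N_def)
qed

end
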